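(* Let $q>0$ and $F=0$ (exact output). Let $P(t)$ be a matrix-valued function with $P(t)=P^\star(t)\in\mathbb{C}^{N\times N}$ (it may depend on the filter state $\hat{\vec\omega}(t)$) such that, for every $(\vec\omega_0,\vec f,\vec\eta)\in\mathcal E$, the filter equation $$\frac{d\hat{\vec\omega}}{dt}=B(\hat{\vec\omega})\hat{\vec\omega}+A\hat{\vec\omega}+PH^\star(\vec y-H\hat{\vec\omega}),\qquad \hat{\vec\omega}(0)=0,$$ driven by the output $\vec y(t)=H\vec\omega(t)$ of the state equation $$\frac{d\vec\omega}{dt}=B(\vec\omega)\vec\omega+A\vec\omega+D\vec f,\qquad \vec\omega(0)=\vec\omega_0,$$ has a solution $\hat{\vec\omega}$ on $t\ge 0$, and along this solution, for all $t\ge0$, the linear matrix inequality $$B_1(\hat{\vec\omega})+B_1^\star(\hat{\vec\omega})+DQD^\star-PH^\star H-H^\star HP<-qI$$ holds. Then for all $t\ge 0$ $$\max_{(\vec\omega_0,\vec f,\vec\eta)\in\mathcal E}\sigma(t)\le C_1(q)+C_2(q)\,e^{-(2|\lambda(A)|+q)t},$$ where $\sigma(t)=\bigl(\vec\omega(t)-\hat{\vec\omega}(t),\,\vec\omega(t)-\hat{\vec\omega}(t)\bigr)_{\mathbb{C}^N}$ is the squared estimation error corresponding to $(\vec\omega_0,\vec f,\vec\eta)$, $C_1(q):=\frac{1}{2|\lambda(A)|+q}$, $C_2(q):=\lambda(S)-\frac{1}{2|\lambda(A)|+q}$, and $\lambda(X)$ denotes the maximal eigenvalue of the matrix $X$.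
   Context: Setting: Fourier-Galerkin approximation of the 2D Navier-Stokes vorticity equation on the periodic rectangle $\Omega=(0,L_x)\times(0,L_y)$ with zero mean velocity and diffusion coefficient $\nu>0$. $N_1,N_2$ are even positive integers and $N:=(N_1+1)(N_2+1)$. Vectors in $\mathbb{C}^N$ are indexed by modes $(c,d)\in\mathbb{Z}^2$ with $|c|\le N_1/2$, $|d|\le N_2/2$, ordered lexicographically (so mode $(0,0)$ is in the middle and the $j$-th mode from the start is the negative of the $j$-th mode from the end). $X^\star$ is the conjugate transpose, $(x,y)_{\mathbb{C}^n}=\sum_j x_j\overline{y_j}$, and $X<Y$ for Hermitian matrices means $Y-X$ is positive definite. $L^2(\Omega)$ carries the inner product $(f,g)_{L^2(\Omega)}=\frac{1}{L_xL_y}\int_\Omega f\overline g\,dx\,dy$, and $\phi_{cd}(x,y)=e^{2\pi i cx/L_x}e^{2\pi i dy/L_y}$. Matrices of the model: - $A=-\nu\,\mathrm{diag}(\lambda_{cd})$ over all modes, with $\lambda_{cd}=\frac{4\pi^2c^2}{L_x^2}+\frac{4\pi^2d^2}{L_y^2}$ (so $\lambda_{00}=0$). - For $\vec\omega=\{\omega_{pq}\}\in\mathbb{C}^N$, $B(\vec\omega)$ is the $N\times N$ matrix whose entry in row $(c,d)$, column $(n,m)$ is $$-\sum_{(p,q)\ne(0,0)}\frac{\omega_{pq}(pm-qn)L_xL_y}{p^2L_y^2+q^2L_x^2}\,\delta_{p+n,c}\,\delta_{q+m,d},$$ the sum being over modes $|p|\le N_1/2$, $|q|\le N_2/2$. (Here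 the summation index $q$ is unrelated to the scalar $q>0$ of the claim.) - $D$ is the $N\times N$ matrix of a given bounded linear operator $\mathcal D$ on $L^2(\Omega)$ in the basis $\{\phi_{cd}\}$: $(D\vec f)_{cd}=\sum_{m,n}(\mathcal D\phi_{mn},\phi_{cd})_{L^2(\Omega)}f_{mn}$. - $H$ is the $M\times N$ matrix with entries $(H_k,\phi_{s_1,s_2})_{L^2(\Omega)}$ for given averaging kernels $H_k$, $k=1,\dots,M$. In general the output is $\vec y=H\vec\omega+F\vec\eta$ with a given $M\times M$ matrix $F$; here $F=0$. - $\Psi$ is the $N\times N$ matrix $$\Psi=\frac{1}{\sqrt2}\begin{pmatrix} I_n & 0 & J_n \\ 0 & 0 & 0 \\ J_n & 0 & -I_n \end{pmatrix},\qquad n=\frac{N-1}{2},$$ where $I_n$ is the identity, $J_n$ the row-reversed identity, and the middle row and column have size one. - $B_1(\hat{\vec\omega}):=\bigl(B(\Psi e_1)\hat{\vec\omega}\ \cdots\ B(\Psi e_N)\hat{\vec\omega}\bigr)\Psi^\star$, where $e_j$ is the $j$-th canonical basis vector and the bracket is the matrix with the indicated columns. Uncertainty: $Q=Q(t)$, $R=R(t)$, $S$ are given positive definite Hermitian matrices of sizes $N$, $M$, $N$. $\mathcal E$ is the set of triples $(\vec\omega_0,\vec f,\vec\eta)$, with $\vec f,\vec\eta$ measurable functions of $t$, such that $(S^{-1}\vec\omega_0,\vec\omega_0)_{\mathbb{C}^N}\le1$ and $(Q^{-1}(t)\vec f(t),\vec f(t))_{\mathbb{C}^N}+(R^{-1}(t)\vec\eta(t),\vec\eta(t))_{\mathbb{C}^M}\le1$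 for all $t\ge 0$. Standing assumption: the state represents a real-valued, zero-mean vorticity, i.e. the data are such that the solution of the state equation satisfies $\omega_{-c,-d}(t)=\overline{\omega_{cd}(t)}$ for all modes and $\omega_{00}(t)=0$ for all $t\ge0$; the elements of $\mathcal E$ are understood to be of this kind. For each such triple the state equation has a unique solution $\vec\omega$ on $t\ge0$. Solutions of differential equations are absolutely continuous and satisfy the equation for almost every $t$. The maximum over $\mathcal E$ is understood as a supremum. *)

theory Defs
  imports
    "HOL-Analysis.Lebesgue_Measure"
    "Jordan_Normal_Form.Schur_Decomposition"
    "Jordan_Normal_Form.Gauss_Jordan_Elimination"
begin

section \<open>Complex matrices\<close>

definition pos_def :: "nat \<Rightarrow> complex mat \<Rightarrow> bool" where
  "pos_def n X \<longleftrightarrow> X \<in> carrier_mat n n \<and> mat_adjoint X = X \<and>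
     (\<forall>v\<in>carrier_vec n. v \<noteq> 0\<^sub>v n \<longrightarrow> 0 < Re ((X *\<^sub>v v) \<bullet>c v))"

definition pd_less :: "nat \<Rightarrow> complex mat \<Rightarrow> complex mat \<Rightarrow> bool" where
  "pd_less n X Y \<longleftrightarrow> pos_def n (Y - X)"

text \<open>Only used for Hermitian matrices, all of whose eigenvalues are real.\<close>

definition max_eigval :: "complex mat \<Rightarrow> real" where
  "max_eigval X = Max {r. eigenvalue X (complex_of_real r)}"

section \<open>The space of square integrable functions on the periodic rectangle\<close>

abbreviation rect :: "real \<Rightarrow> real \<Rightarrow> (real \<times> real) measure" where
  "rect Lx Ly \<equiv> lebesgue_on ({0<..<Lx} \<times> {0<..<Ly})"

text \<open>Elements of the Hilbert space are represented by functions; identities between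
  them are understood almost everywhere.\<close>

definition L2 :: "real \<Rightarrow> real \<Rightarrow> (real \<times> real \<Rightarrow> complex) set" where
  "L2 Lx Ly = {f \<in> borel_measurable (rect Lx Ly). integrable (rect Lx Ly) (\<lambda>z. (norm (f z))\<^sup>2)}"

definition L2_inner ::
    "real \<Rightarrow> real \<Rightarrow> (real \<times> real \<Rightarrow> complex) \<Rightarrow> (real \<times> real \<Rightarrow> complex) \<Rightarrow> complex" where
  "L2_inner Lx Ly f g =
     complex_of_real (1 / (Lx * Ly)) * (\<integral>z. f z * cnj (g z) \<partial>(rect Lx Ly))"

definition L2_nrm :: "real \<Rightarrow> real \<Rightarrow> (real \<times> real \<Rightarrow> complex) \<Rightarrow> real" where
  "L2_nrm Lx Ly f = sqrt (Re (L2_inner Lx Ly f f))"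

text \<open>Compatibility with almost everywhere equality need not be required separately: it
  follows from linearity and boundedness.\<close>

definition L2_bounded_operator ::
    "real \<Rightarrow> real \<Rightarrow> ((real \<times> real \<Rightarrow> complex) \<Rightarrow> (real \<times> real \<Rightarrow> complex)) \<Rightarrow> bool" where
  "L2_bounded_operator Lx Ly T \<longleftrightarrow>
     (\<forall>f\<in>L2 Lx Ly. T f \<in> L2 Lx Ly) \<and>
     (\<forall>f\<in>L2 Lx Ly. \<forall>g\<in>L2 Lx Ly. \<forall>a b. AE z in rect Lx Ly.
        T (\<lambda>z. a * f z + b * g z) z = a * T f z + b * T g z) \<and>
     (\<exists>K. \<forall>f\<in>L2 Lx Ly. L2_nrm Lx Ly (T f) \<le> K * L2_nrm Lx Ly f)"

definition fourier :: "real \<Rightarrow> real \<Rightarrow> int \<times> int \<Rightarrow> real \<times> real \<Rightarrow> complex" where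
  "fourier Lx Ly = (\<lambda>(c, d) (x, y).
     exp (2 * of_real pi * \<i> * of_int c * of_real x / of_real Lx) *
     exp (2 * of_real pi * \<i> * of_int d * of_real y / of_real Ly))"

section \<open>Fourier modes and the Galerkin matrices\<close>

definition n_modes :: "nat \<Rightarrow> nat \<Rightarrow> nat" where
  "n_modes N1 N2 = (N1 + 1) * (N2 + 1)"

text \<open>The \<open>j\<close>-th mode (\<open>j < n_modes N1 N2\<close>) in the lexicographic order of
  \<open>{-N1/2..N1/2} \<times> {-N2/2..N2/2}\<close>.\<close>

definition mode :: "nat \<Rightarrow> nat \<Rightarrow> nat \<Rightarrow> int \<times> int" where
  "mode N1 N2 j =
     (int (j div (N2 + 1)) - int (N1 div 2), int (j mod (N2 + 1)) - int (N2 div 2))"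

definition laplace_eig :: "real \<Rightarrow> real \<Rightarrow> int \<times> int \<Rightarrow> real" where
  "laplace_eig Lx Ly = (\<lambda>(c, d).
     4 * pi\<^sup>2 * (of_int c)\<^sup>2 / Lx\<^sup>2 + 4 * pi\<^sup>2 * (of_int d)\<^sup>2 / Ly\<^sup>2)"

definition diffusion_mat :: "nat \<Rightarrow> nat \<Rightarrow> real \<Rightarrow> real \<Rightarrow> real \<Rightarrow> complex mat" where
  "diffusion_mat N1 N2 Lx Ly \<nu> =
     mat_diag (n_modes N1 N2) (\<lambda>j. complex_of_real (- \<nu> * laplace_eig Lx Ly (mode N1 N2 j)))"

definition convection_mat ::
    "nat \<Rightarrow> nat \<Rightarrow> real \<Rightarrow> real \<Rightarrow> complex vec \<Rightarrow> complex mat" where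
  "convection_mat N1 N2 Lx Ly w = mat (n_modes N1 N2) (n_modes N1 N2) (\<lambda>(i, j).
     let (c, d) = mode N1 N2 i; (n, m) = mode N1 N2 j in
     - (\<Sum>k | k < n_modes N1 N2 \<and> mode N1 N2 k \<noteq> (0, 0).
          let (p, q) = mode N1 N2 k in
          if p + n = c \<and> q + m = d
          then w $ k * complex_of_real
                 (of_int (p * m - q * n) * Lx * Ly / ((of_int p)\<^sup>2 * Ly\<^sup>2 + (of_int q)\<^sup>2 * Lx\<^sup>2))
          else 0))"

definition operator_mat ::
    "nat \<Rightarrow> nat \<Rightarrow> real \<Rightarrow> real \<Rightarrow> ((real \<times> real \<Rightarrow> complex) \<Rightarrow> (real \<times> real \<Rightarrow> complex))
       \<Rightarrow> complex mat" where
  "operator_mat N1 N2 Lx Ly T = mat (n_modes N1 N2) (n_modes N1 N2) (\<lambda>(i, j).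
     L2_inner Lx Ly (T (fourier Lx Ly (mode N1 N2 j))) (fourier Lx Ly (mode N1 N2 i)))"

definition observation_mat ::
    "nat \<Rightarrow> nat \<Rightarrow> real \<Rightarrow> real \<Rightarrow> nat \<Rightarrow> (nat \<Rightarrow> real \<times> real \<Rightarrow> complex) \<Rightarrow> complex mat" where
  "observation_mat N1 N2 Lx Ly M h = mat M (n_modes N1 N2) (\<lambda>(k, j).
     L2_inner Lx Ly (h k) (fourier Lx Ly (mode N1 N2 j)))"

text \<open>With \<open>n = (N - 1) / 2\<close>, the entries of the blocks \<open>I\<close> and \<open>- I\<close> lie on the
  diagonal, those of the two blocks \<open>J\<close> on the antidiagonal \<open>i + j = 2 * n\<close>.\<close>

definition Psi_mat :: "nat \<Rightarrow> complex mat" where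
  "Psi_mat N = (let n = (N - 1) div 2 in
     complex_of_real (1 / sqrt 2) \<cdot>\<^sub>m mat N N (\<lambda>(i, j).
       if i = j then (if i < n then 1 else if n < i then - 1 else 0)
       else if i + j = 2 * n then 1 else 0))"

definition B1_mat :: "nat \<Rightarrow> nat \<Rightarrow> real \<Rightarrow> real \<Rightarrow> complex vec \<Rightarrow> complex mat" where
  "B1_mat N1 N2 Lx Ly v = (let N = n_modes N1 N2 in
     mat_of_cols N
       (map (\<lambda>j. convection_mat N1 N2 Lx Ly (Psi_mat N *\<^sub>v unit_vec N j) *\<^sub>v v) [0..<N])
     * mat_adjoint (Psi_mat N))"

section \<open>Differential equations\<close>

definition abs_cont_on :: "real \<Rightarrow> real \<Rightarrow> (real \<Rightarrow> complex) \<Rightarrow> bool" where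
  "abs_cont_on a b x \<longleftrightarrow> (\<forall>\<epsilon>>0. \<exists>\<delta>>0. \<forall>(n::nat) u v.
     (\<forall>i<n. a \<le> u i \<and> u i \<le> v i \<and> v i \<le> b) \<and>
     disjoint_family_on (\<lambda>i. {u i<..<v i}) {..<n} \<and> (\<Sum>i<n. v i - u i) < \<delta>
     \<longrightarrow> (\<Sum>i<n. norm (x (v i) - x (u i))) < \<epsilon>)"

text \<open>\<open>x\<close> solves \<open>x' = rhs t x\<close>, \<open>x 0 = x0\<close> on the half-line \<open>t \<ge> 0\<close>. The values of \<open>x\<close>
  at negative times are irrelevant.\<close>

definition solves_ivp ::
    "nat \<Rightarrow> (real \<Rightarrow> complex vec \<Rightarrow> complex vec) \<Rightarrow> complex vec \<Rightarrow> (real \<Rightarrow> complex vec) \<Rightarrow> bool"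
  where
  "solves_ivp N rhs x0 x \<longleftrightarrow>
     (\<forall>t\<ge>0. x t \<in> carrier_vec N) \<and> x 0 = x0 \<and>
     (\<forall>j<N. \<forall>T\<ge>0. abs_cont_on 0 T (\<lambda>t. x t $ j)) \<and>
     (AE t in lebesgue_on {0..}. \<forall>j<N.
        ((\<lambda>s. x s $ j) has_vector_derivative (rhs t (x t) $ j)) (at t within {0..}))"

definition state_solution ::
    "nat \<Rightarrow> nat \<Rightarrow> real \<Rightarrow> real \<Rightarrow> complex mat \<Rightarrow> complex mat \<Rightarrow> complex vec
       \<Rightarrow> (real \<Rightarrow> complex vec) \<Rightarrow> (real \<Rightarrow> complex vec) \<Rightarrow> bool" where
  "state_solution N1 N2 Lx Ly A D w0 f w \<longleftrightarrow>
     solves_ivp (n_modes N1 N2)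
       (\<lambda>t x. convection_mat N1 N2 Lx Ly x *\<^sub>v x + A *\<^sub>v x + D *\<^sub>v f t) w0 w"

definition output_signal ::
    "complex mat \<Rightarrow> complex mat \<Rightarrow> (real \<Rightarrow> complex vec) \<Rightarrow> (real \<Rightarrow> complex vec)
       \<Rightarrow> real \<Rightarrow> complex vec" where
  "output_signal H F w \<eta> t = H *\<^sub>v w t + F *\<^sub>v \<eta> t"

text \<open>The gain \<open>P\<close> may depend on time and on the current filter state.\<close>

definition filter_solution ::
    "nat \<Rightarrow> nat \<Rightarrow> real \<Rightarrow> real \<Rightarrow> complex mat \<Rightarrow> complex mat
       \<Rightarrow> (real \<Rightarrow> complex vec \<Rightarrow> complex mat) \<Rightarrow> (real \<Rightarrow> complex vec)
       \<Rightarrow> (real \<Rightarrow> complex vec) \<Rightarrow> bool" where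
  "filter_solution N1 N2 Lx Ly A H P y wh \<longleftrightarrow>
     solves_ivp (n_modes N1 N2)
       (\<lambda>t x. convection_mat N1 N2 Lx Ly x *\<^sub>v x + A *\<^sub>v x
              + (P t x * mat_adjoint H) *\<^sub>v (y t - H *\<^sub>v x))
       (0\<^sub>v (n_modes N1 N2)) wh"

section \<open>The uncertainty set\<close>

definition real_zero_mean :: "nat \<Rightarrow> nat \<Rightarrow> complex vec \<Rightarrow> bool" where
  "real_zero_mean N1 N2 v \<longleftrightarrow>
     (\<forall>i<n_modes N1 N2. \<forall>j<n_modes N1 N2.
        mode N1 N2 i = (- fst (mode N1 N2 j), - snd (mode N1 N2 j)) \<longrightarrow> v $ i = cnj (v $ j)) \<and>
     (\<forall>j<n_modes N1 N2. mode N1 N2 j = (0, 0) \<longrightarrow> v $ j = 0)"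

definition measurable_signal :: "nat \<Rightarrow> (real \<Rightarrow> complex vec) \<Rightarrow> bool" where
  "measurable_signal n f \<longleftrightarrow> (\<forall>t\<ge>0. f t \<in> carrier_vec n) \<and>
     (\<forall>j<n. (\<lambda>t. f t $ j) \<in> borel_measurable (lebesgue_on {0..}))"

definition inv_form :: "complex mat \<Rightarrow> complex vec \<Rightarrow> real" where
  "inv_form X v = Re ((the (mat_inverse X) *\<^sub>v v) \<bullet>c v)"

text \<open>Besides the ellipsoidal bounds, the set carries the standing requirement on the
  data: the state equation has a unique solution on \<open>t \<ge> 0\<close>, and this solution represents
  a real-valued vorticity of zero mean.\<close>

definition uncertainty_set ::
    "nat \<Rightarrow> nat \<Rightarrow> real \<Rightarrow> real \<Rightarrow> complex mat \<Rightarrow> complex mat \<Rightarrow> nat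
       \<Rightarrow> (real \<Rightarrow> complex mat) \<Rightarrow> (real \<Rightarrow> complex mat) \<Rightarrow> complex mat
       \<Rightarrow> (complex vec \<times> (real \<Rightarrow> complex vec) \<times> (real \<Rightarrow> complex vec)) set" where
  "uncertainty_set N1 N2 Lx Ly A D M Q R S = {(w0, f, \<eta>).
     w0 \<in> carrier_vec (n_modes N1 N2) \<and>
     measurable_signal (n_modes N1 N2) f \<and> measurable_signal M \<eta> \<and>
     inv_form S w0 \<le> 1 \<and>
     (\<forall>t\<ge>0. inv_form (Q t) (f t) + inv_form (R t) (\<eta> t) \<le> 1) \<and>
     (\<exists>w. state_solution N1 N2 Lx Ly A D w0 f w \<and>
          (\<forall>w'. state_solution N1 N2 Lx Ly A D w0 f w' \<longrightarrow> (\<forall>t\<ge>0. w' t = w t)) \<and>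
          (\<forall>t\<ge>0. real_zero_mean N1 N2 (w t)))}"

section \<open>Error bound\<close>

definition sq_error ::
    "(real \<Rightarrow> complex vec) \<Rightarrow> (real \<Rightarrow> complex vec) \<Rightarrow> real \<Rightarrow> real" where
  "sq_error w wh t = Re ((w t - wh t) \<bullet>c (w t - wh t))"

definition C1 :: "complex mat \<Rightarrow> real \<Rightarrow> real" where
  "C1 A q = 1 / (2 * \<bar>max_eigval A\<bar> + q)"

definition C2 :: "complex mat \<Rightarrow> complex mat \<Rightarrow> real \<Rightarrow> real" where
  "C2 A S q = max_eigval S - 1 / (2 * \<bar>max_eigval A\<bar> + q)"

end

theory Submission
  imports Defs "HOL-Analysis.Tagged_Division"
begin

text \<open>Write \<open>e = \<omega> - \<omega>h\<close> for the estimation error and \<open>\<sigma> = \<parallel>e\<parallel>\<^sup>2\<close>. The theorem is the integrated form of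
  the differential inequality \<open>\<sigma>' \<le> 1 - q \<sigma>\<close>, with the initial bound \<open>\<sigma> 0 \<le> \<lambda>(S)\<close>. The largest
  eigenvalue of the diffusion matrix is 0, attained at the mode \<open>(0, 0)\<close>, so the decay rate
  \<open>2 \<bar>\<lambda>(A)\<bar> + q\<close> of the claim is \<open>q\<close> (lemma \<open>max_eigval_diffusion_mat\<close>).

  The differential inequality (lemma \<open>error_dissipation\<close>) rests on two facts about the convection
  matrix \<open>B\<close>. First, \<open>B(\<omega>) \<omega> - B(\<omega>h) \<omega>h = B(\<omega>) e + B(e) \<omega>h\<close>, and \<open>B(\<omega>)\<close> is skew-Hermitian for
  a real vorticity \<open>\<omega>\<close>, so that the first term does not contribute to \<open>\<sigma>'\<close> (lemma
  \<open>convection_energy_conservation\<close>). Secondly, \<open>B(e) \<omega>h\<close> equals \<open>B1(\<omega>h) e\<close> (lemma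
  \<open>B1_mat_mult_vec\<close>), a linear term that the matrix inequality controls. The diffusion has a sign,
  the gain \<open>P\<close> contributes the forms of \<open>P H\<^sup>\<star> H\<close> and \<open>H\<^sup>\<star> H P\<close>, and the input is estimated by
  \<open>2 (D f, e) \<le> (Q\<^sup>-\<^sup>1 f, f) + (D Q D\<^sup>\<star> e, e)\<close> (lemma \<open>inv_form_young\<close>), whose first summand is at
  most 1 on the uncertainty set.

  The solutions are absolutely continuous and differentiable almost everywhere, so the integration
  requires that an absolutely continuous function whose derivative is nonpositive almost everywhere
  is decreasing (lemma \<open>abs_cont_decreasing\<close>), proved with a gauge and Cousin's lemma. The initial bound
  needs \<open>\<parallel>w\<parallel>\<^sup>2 \<le> \<lambda>(S) (S\<^sup>-\<^sup>1 w, w)\<close> (lemma \<open>rinner_self_le_max_eigval_inv_form\<close>), for which the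
  largest eigenvalue of a Hermitian matrix is shown to dominate its Rayleigh quotient (lemma
  \<open>rinner_le_max_eigval\<close>).\<close>

section \<open>Absolutely continuous functions\<close>

text \<open>The definition of absolute continuity speaks of families indexed by initial segments
  of the naturals; the cells of a tagged division carry no such numbering, so the same \<open>\<delta>\<close> is
  transported along an enumeration of an arbitrary finite index set.\<close>

lemma abs_cont_on_finite_family:
  assumes "abs_cont_on a b x" "0 < \<epsilon>"
  shows "\<exists>\<delta>>0. \<forall>(I::'i set) u v. finite I \<and> (\<forall>i\<in>I. a \<le> u i \<and> u i \<le> v i \<and> v i \<le> b) \<and>
    disjoint_family_on (\<lambda>i. {u i<..<v i}) I \<and> (\<Sum>i\<in>I. v i - u i) < \<delta> \<longrightarrow>
    (\<Sum>i\<in>I. norm (x (v i) - x (u i))) < \<epsilon>"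
proof -
  obtain \<delta> where "0 < \<delta>" and \<delta>: "\<forall>(n::nat) u v.
     (\<forall>i<n. a \<le> u i \<and> u i \<le> v i \<and> v i \<le> b) \<and>
     disjoint_family_on (\<lambda>i. {u i<..<v i}) {..<n} \<and> (\<Sum>i<n. v i - u i) < \<delta>
     \<longrightarrow> (\<Sum>i<n. norm (x (v i) - x (u i))) < \<epsilon>"
    using assms(1)[unfolded abs_cont_on_def, rule_format, OF assms(2)] by (elim exE conjE)
  have "(\<Sum>i\<in>I. norm (x (v i) - x (u i))) < \<epsilon>"
    if I: "finite I" "\<forall>i\<in>I. a \<le> u i \<and> u i \<le> v i \<and> v i \<le> b"
      and disj: "disjoint_family_on (\<lambda>i. {u i<..<v i}) I"
      and len: "(\<Sum>i\<in>I. v i - u i) < \<delta>" for I :: "'i set" and u v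
  proof -
    obtain g where g: "bij_betw g {..<card I} I"
      using ex_bij_betw_nat_finite[OF I(1)] by (auto simp: lessThan_atLeast0)
    have gI: "g i \<in> I" if "i < card I" for i
      using g that by (auto simp: bij_betw_def)
    have "disjoint_family_on (\<lambda>i. {u (g i)<..<v (g i)}) {..<card I}"
      unfolding disjoint_family_on_def
    proof (intro ballI impI)
      fix i j assume ij: "i \<in> {..<card I}" "j \<in> {..<card I}" "i \<noteq> j"
      then have "g i \<noteq> g j"
        using g by (auto simp: bij_betw_def inj_on_def)
      then show "{u (g i)<..<v (g i)} \<inter> {u (g j)<..<v (g j)} = {}"
        using disj gI ij unfolding disjoint_family_on_def by (metis lessThan_iff)
    qed
    moreover have "(\<Sum>i<card I. v (g i) - u (g i)) < \<delta>"
      using len sum.reindex_bij_betw[OF g, of "\<lambda>i. v i - u i"] by simp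
    ultimately have "(\<Sum>i<card I. norm (x (v (g i)) - x (u (g i)))) < \<epsilon>"
      using gI I(2) by (intro \<delta>[rule_format, of "card I" "\<lambda>i. u (g i)" "\<lambda>i. v (g i)"]) auto
    then show ?thesis
      using sum.reindex_bij_betw[OF g, of "\<lambda>i. norm (x (v i) - x (u i))"] by simp
  qed
  with \<open>0 < \<delta>\<close> show ?thesis by (intro exI[of _ \<delta>]) simp
qed

lemma sum_lengths_le_measure:
  fixes u v :: "'i \<Rightarrow> real"
  assumes "finite I" "\<And>i. i \<in> I \<Longrightarrow> u i \<le> v i \<and> {u i<..<v i} \<subseteq> G"
    and "disjoint_family_on (\<lambda>i. {u i<..<v i}) I" "open G" "emeasure lborel G < ennreal \<delta>"
  shows "(\<Sum>i\<in>I. v i - u i) < \<delta>"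
proof -
  have "ennreal (\<Sum>i\<in>I. v i - u i) = (\<Sum>i\<in>I. emeasure lborel {u i<..<v i})"
    using assms(2) by (subst sum_ennreal[symmetric]) (auto intro!: sum.cong)
  also have "\<dots> = emeasure lborel (\<Union>i\<in>I. {u i<..<v i})"
    using assms by (intro sum_emeasure) auto
  also have "\<dots> \<le> emeasure lborel G"
    using assms by (intro emeasure_mono) auto
  also have "\<dots> < ennreal \<delta>" by fact
  finally show ?thesis
    using assms(2) by (subst (asm) ennreal_less_iff) (auto intro: sum_nonneg)
qed

text \<open>The exceptional null set \<open>Z\<close>, on which nothing is known about the derivative, is
  harmless because absolute continuity bounds the growth over intervals of small total length.
  Cover \<open>Z\<close> by an open set \<open>G\<close> of measure below the \<open>\<delta>\<close> belonging to \<open>\<epsilon>\<close>, and let a gauge confine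
  a cell to \<open>G\<close> if its tag lies in \<open>Z\<close>, and otherwise to a ball on which the growth is at most \<open>\<epsilon>\<close>
  times the length. Cousin's lemma supplies a fine division; summing the increments over its cells
  shows that the total growth is at most \<open>\<epsilon> * (b - a) + \<epsilon>\<close>.\<close>

lemma abs_cont_decreasing:
  fixes x :: "real \<Rightarrow> complex"
  assumes ab: "a \<le> b" and ac: "abs_cont_on a b x"
    and der: "AE t in lebesgue_on {a..b}.
      \<exists>D. (x has_vector_derivative D) (at t within {a..b}) \<and> Re D \<le> 0"
  shows "Re (x b) \<le> Re (x a)"
proof -
  define good where "good t \<longleftrightarrow>
    (\<exists>D. (x has_vector_derivative D) (at t within {a..b}) \<and> Re D \<le> 0)" for t
  have "AE t in lebesgue. t \<in> {a..b} \<longrightarrow> good t"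
    using der unfolding good_def by (subst (asm) AE_restrict_space_iff) auto
  then obtain Z where Z: "Z \<in> sets lebesgue" "emeasure lebesgue Z = 0"
    and good: "\<And>t. t \<in> {a..b} \<Longrightarrow> t \<notin> Z \<Longrightarrow> good t"
  proof (rule AE_E)
    fix Z assume Z: "{t \<in> space lebesgue. \<not> (t \<in> {a..b} \<longrightarrow> good t)} \<subseteq> Z"
      "emeasure lebesgue Z = 0" "Z \<in> sets lebesgue"
    show thesis
    proof (rule that[OF Z(3,2)])
      show "good t" if "t \<in> {a..b}" "t \<notin> Z" for t
        by (rule ccontr) (use Z(1) that in auto)
    qed
  qed
  have bound: "Re (x b) - Re (x a) \<le> \<epsilon> * (b - a) + \<epsilon>" if "0 < \<epsilon>" for \<epsilon> :: real
  proof -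
    obtain \<delta> where \<delta>: "0 < \<delta>" and small: "\<forall>(I::(real \<times> real set) set) u v.
        finite I \<and> (\<forall>i\<in>I. a \<le> u i \<and> u i \<le> v i \<and> v i \<le> b) \<and>
        disjoint_family_on (\<lambda>i. {u i<..<v i}) I \<and> (\<Sum>i\<in>I. v i - u i) < \<delta> \<longrightarrow>
        (\<Sum>i\<in>I. norm (x (v i) - x (u i))) < \<epsilon>"
      using abs_cont_on_finite_family[OF ac \<open>0 < \<epsilon>\<close>, where 'i="real \<times> real set"]
      by (elim exE conjE)
    obtain G where G: "open G" "Z \<subseteq> G" "emeasure lebesgue (G - Z) < ennreal \<delta>"
      using sets_lebesgue_outer_open[OF Z(1) \<delta>] by metis
    have "emeasure lebesgue G \<le> emeasure lebesgue (G - Z) + emeasure lebesgue Z"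
    proof -
      have "(G - Z) \<union> Z = G" using G(2) by blast
      moreover have "G - Z \<in> sets lebesgue" using G(1) Z(1) by (intro sets.Diff lborelD borel_open) auto
      ultimately show ?thesis
        using emeasure_subadditive[of "G - Z" lebesgue Z] Z(1) by simp
    qed
    then have Gsmall: "emeasure lborel G < ennreal \<delta>"
      using G Z(2) by (simp add: order.strict_trans1)
    \<comment> \<open>the tag \<open>t\<close> separates \<open>u\<close> from \<open>v\<close>, so both increments use the derivative at \<open>t\<close>\<close>
    have "\<exists>r>0. \<forall>u v. u \<in> {a..t} \<longrightarrow> v \<in> {t..b} \<longrightarrow> {u..v} \<subseteq> ball t r \<longrightarrow>
            Re (x v) - Re (x u) \<le> \<epsilon> * (v - u)" if t: "t \<in> {a..b}" "t \<notin> Z" for t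
    proof -
      obtain D where D: "(x has_vector_derivative D) (at t within {a..b})" "Re D \<le> 0"
        using good[OF t] unfolding good_def by blast
      then obtain r where r: "0 < r" and close: "\<And>y. y \<in> {a..b} \<Longrightarrow> \<bar>y - t\<bar> < r \<Longrightarrow>
          norm (x y - x t - (y - t) *\<^sub>R D) \<le> \<epsilon> * \<bar>y - t\<bar>"
        using \<open>0 < \<epsilon>\<close> unfolding has_vector_derivative_def has_derivative_within_alt real_norm_def
        by meson
      have "Re (x v) - Re (x u) \<le> \<epsilon> * (v - u)"
        if u: "u \<in> {a..t}" and v: "v \<in> {t..b}" and sub: "{u..v} \<subseteq> ball t r" for u v
      proof -
        have "u \<in> {u..v}" "v \<in> {u..v}" using u v by auto
        then have "u \<in> ball t r" "v \<in> ball t r" using sub by blast+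
        then have uv: "\<bar>u - t\<bar> < r" "\<bar>v - t\<bar> < r" by (auto simp: dist_real_def)
        have "Re (x v - x t - (v - t) *\<^sub>R D) \<le> \<epsilon> * \<bar>v - t\<bar>"
          using close[of v] uv v t by (intro order_trans[OF complex_Re_le_cmod]) auto
        moreover have "- Re (x u - x t - (u - t) *\<^sub>R D) \<le> \<epsilon> * \<bar>u - t\<bar>"
          using close[of u] uv u t abs_Re_le_cmod[of "x u - x t - (u - t) *\<^sub>R D"] by auto
        moreover have "(v - t) * Re D \<le> 0" "0 \<le> (u - t) * Re D"
          using u v D(2) by (auto intro: mult_nonneg_nonpos mult_nonpos_nonpos)
        ultimately show ?thesis
          using u v by (auto simp: algebra_simps)
      qed
      then show ?thesis using r by blast
    qed
    then obtain r where r: "\<And>t. t \<in> {a..b} \<Longrightarrow> t \<notin> Z \<Longrightarrow> 0 < r t"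
      and r_bound: "\<And>t u v. t \<in> {a..b} \<Longrightarrow> t \<notin> Z \<Longrightarrow> u \<in> {a..t} \<Longrightarrow> v \<in> {t..b} \<Longrightarrow>
        {u..v} \<subseteq> ball t (r t) \<Longrightarrow> Re (x v) - Re (x u) \<le> \<epsilon> * (v - u)"
      by metis
    define \<gamma> where "\<gamma> t = (if t \<in> Z then G else if t \<in> {a..b} then ball t (r t) else UNIV)" for t
    have "gauge \<gamma>"
      unfolding gauge_def \<gamma>_def using G r by auto
    then obtain p where p: "p tagged_division_of {a..b}" "\<gamma> fine p"
      using fine_division_exists_real by blast
    note pD = tagged_division_ofD[OF p(1)]
    have cell: "\<exists>u v. K = {u..v} \<and> a \<le> u \<and> u \<le> t \<and> t \<le> v \<and> v \<le> b \<and> Inf K = u \<and> Sup K = v \<and>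
        t \<in> {a..b} \<and> {u..v} \<subseteq> \<gamma> t" if tK: "(t, K) \<in> p" for t K
    proof -
      obtain u v where K: "K = {u..v}" using pD(4)[OF tK] by auto
      moreover have "t \<in> K" "K \<subseteq> {a..b}" "K \<subseteq> \<gamma> t"
        using pD(2,3)[OF tK] p(2) tK by (auto simp: fine_def)
      ultimately show ?thesis by (intro exI[of _ u] exI[of _ v]) auto
    qed
    have cell_interior: "interior K = {Inf K<..<Sup K}" if tK: "(t, K) \<in> p" for t K
    proof -
      obtain u v where "K = {u..v}" "Inf K = u" "Sup K = v" using cell[OF tK] by blast
      then show ?thesis by simp
    qed
    define bad where "bad = {tK \<in> p. fst tK \<in> Z}"
    have fin: "finite p" "finite bad" using pD(1) by (auto simp: bad_def)
    have bad_disj: "disjoint_family_on (\<lambda>i. {Inf (snd i)<..<Sup (snd i)}) bad"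
      unfolding disjoint_family_on_def
    proof (intro ballI impI)
      fix i j assume ij: "i \<in> bad" "j \<in> bad" "i \<noteq> j"
      then obtain s K t L where eq: "i = (s, K)" "j = (t, L)" "(s, K) \<in> p" "(t, L) \<in> p"
        unfolding bad_def by (cases i, cases j) auto
      have "interior K \<inter> interior L = {}" using pD(5) eq ij by blast
      then show "{Inf (snd i)<..<Sup (snd i)} \<inter> {Inf (snd j)<..<Sup (snd j)} = {}"
        using cell_interior[OF eq(3)] cell_interior[OF eq(4)] eq(1,2) by simp
    qed
    have bad_cell: "a \<le> Inf (snd i) \<and> Inf (snd i) \<le> Sup (snd i) \<and> Sup (snd i) \<le> b \<and>
        {Inf (snd i)<..<Sup (snd i)} \<subseteq> G" if "i \<in> bad" for i
    proof -
      obtain t K where i: "i = (t, K)" "(t, K) \<in> p" "t \<in> Z"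
        using \<open>i \<in> bad\<close> by (cases i) (auto simp: bad_def)
      from cell[OF i(2)] i(3) show ?thesis
        by (auto simp: i(1) \<gamma>_def)
    qed
    have "(\<Sum>i\<in>bad. Sup (snd i) - Inf (snd i)) < \<delta>"
      using bad_cell bad_disj fin G Gsmall by (intro sum_lengths_le_measure) auto
    then have "(\<Sum>i\<in>bad. norm (x (Sup (snd i)) - x (Inf (snd i)))) < \<epsilon>"
      using bad_cell bad_disj fin
      by (intro small[rule_format]) auto
    moreover have "(\<Sum>i\<in>bad. Re (x (Sup (snd i))) - Re (x (Inf (snd i))))
        \<le> (\<Sum>i\<in>bad. norm (x (Sup (snd i)) - x (Inf (snd i))))"
      by (intro sum_mono) (metis complex_Re_le_cmod minus_complex.sel(1))
    moreover have "(\<Sum>i\<in>p - bad. Re (x (Sup (snd i))) - Re (x (Inf (snd i))))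
        \<le> (\<Sum>i\<in>p - bad. \<epsilon> * (Sup (snd i) - Inf (snd i)))"
    proof (intro sum_mono)
      fix i assume "i \<in> p - bad"
      then obtain t K where i: "i = (t, K)" "(t, K) \<in> p" "t \<notin> Z"
        by (cases i) (auto simp: bad_def)
      from cell[OF i(2)] obtain u v where uv: "K = {u..v}" "a \<le> u" "u \<le> t" "t \<le> v" "v \<le> b"
        "Inf K = u" "Sup K = v" "t \<in> {a..b}" "{u..v} \<subseteq> \<gamma> t" by blast
      show "Re (x (Sup (snd i))) - Re (x (Inf (snd i))) \<le> \<epsilon> * (Sup (snd i) - Inf (snd i))"
        using uv i r_bound[of t u v] by (auto simp: \<gamma>_def)
    qed
    moreover have "(\<Sum>i\<in>p - bad. \<epsilon> * (Sup (snd i) - Inf (snd i)))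
        \<le> (\<Sum>i\<in>p. \<epsilon> * (Sup (snd i) - Inf (snd i)))"
    proof (intro sum_mono2)
      fix i assume "i \<in> p - (p - bad)"
      then have "Inf (snd i) \<le> Sup (snd i)"
        using bad_cell by auto
      then show "0 \<le> \<epsilon> * (Sup (snd i) - Inf (snd i))" using \<open>0 < \<epsilon>\<close> by simp
    qed (use fin in auto)
    moreover have "(\<Sum>i\<in>p. \<epsilon> * (Sup (snd i) - Inf (snd i))) = \<epsilon> * (b - a)"
      using additive_tagged_division_1[OF ab p(1), of "\<lambda>s. s"]
      by (simp add: sum_distrib_left[symmetric] case_prod_unfold)
    moreover have "Re (x b) - Re (x a) = (\<Sum>i\<in>p. Re (x (Sup (snd i))) - Re (x (Inf (snd i))))"
      using additive_tagged_division_1[OF ab p(1), of "\<lambda>s. Re (x s)"]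
      by (simp add: case_prod_unfold)
    moreover have "(\<Sum>i\<in>p. Re (x (Sup (snd i))) - Re (x (Inf (snd i))))
       = (\<Sum>i\<in>p - bad. Re (x (Sup (snd i))) - Re (x (Inf (snd i))))
         + (\<Sum>i\<in>bad. Re (x (Sup (snd i))) - Re (x (Inf (snd i))))"
      using fin by (intro sum.subset_diff) (auto simp: bad_def)
    ultimately show ?thesis by linarith
  qed
  have "Re (x b) - Re (x a) \<le> 0 + e" if "0 < e" for e
  proof -
    have "0 < b - a + 1" using ab by simp
    then have "e / (b - a + 1) * (b - a) + e / (b - a + 1) = e"
      using distrib_left[of "e / (b - a + 1)" "b - a" 1] by simp
    with bound[of "e / (b - a + 1)"] that \<open>0 < b - a + 1\<close> show ?thesis by simp
  qed
  then have "Re (x b) - Re (x a) \<le> 0" by (rule field_le_epsilon)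
  then show ?thesis by simp
qed

text \<open>Every closure property below is an instance of this one: an increment controlled by
  the increments of absolutely continuous functions is small when those are.\<close>

lemma abs_cont_on_dominated:
  assumes x: "abs_cont_on a b x" and y: "abs_cont_on a b y" and K: "0 \<le> K"
    and dom: "\<And>s t. a \<le> s \<Longrightarrow> s \<le> t \<Longrightarrow> t \<le> b \<Longrightarrow>
      norm (z t - z s) \<le> K * (norm (x t - x s) + norm (y t - y s))"
  shows "abs_cont_on a b z"
  unfolding abs_cont_on_def
proof (intro allI impI)
  fix \<epsilon> :: real assume "0 < \<epsilon>"
  \<comment> \<open>the summand 1 keeps the denominator positive when \<open>K = 0\<close>\<close>
  define \<epsilon>' where "\<epsilon>' = \<epsilon> / (K + 1) / 2"
  have "0 < \<epsilon>'" using \<open>0 < \<epsilon>\<close> K by (simp add: \<epsilon>'_def)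
  have twice: "\<epsilon>' + \<epsilon>' = \<epsilon> / (K + 1)" unfolding \<epsilon>'_def by (rule field_sum_of_halves)
  obtain \<delta>1 where 1: "0 < \<delta>1" "\<forall>(n::nat) u v.
     (\<forall>i<n. a \<le> u i \<and> u i \<le> v i \<and> v i \<le> b) \<and>
     disjoint_family_on (\<lambda>i. {u i<..<v i}) {..<n} \<and> (\<Sum>i<n. v i - u i) < \<delta>1
     \<longrightarrow> (\<Sum>i<n. norm (x (v i) - x (u i))) < \<epsilon>'"
    using x[unfolded abs_cont_on_def, rule_format, OF \<open>0 < \<epsilon>'\<close>] by (elim exE conjE)
  obtain \<delta>2 where 2: "0 < \<delta>2" "\<forall>(n::nat) u v.
     (\<forall>i<n. a \<le> u i \<and> u i \<le> v i \<and> v i \<le> b) \<and>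
     disjoint_family_on (\<lambda>i. {u i<..<v i}) {..<n} \<and> (\<Sum>i<n. v i - u i) < \<delta>2
     \<longrightarrow> (\<Sum>i<n. norm (y (v i) - y (u i))) < \<epsilon>'"
    using y[unfolded abs_cont_on_def, rule_format, OF \<open>0 < \<epsilon>'\<close>] by (elim exE conjE)
  show "\<exists>\<delta>>0. \<forall>(n::nat) u v. (\<forall>i<n. a \<le> u i \<and> u i \<le> v i \<and> v i \<le> b) \<and>
     disjoint_family_on (\<lambda>i. {u i<..<v i}) {..<n} \<and> (\<Sum>i<n. v i - u i) < \<delta>
     \<longrightarrow> (\<Sum>i<n. norm (z (v i) - z (u i))) < \<epsilon>"
  proof (intro exI[of _ "min \<delta>1 \<delta>2"] conjI allI impI; (elim conjE)?)
    fix n :: nat and u v :: "nat \<Rightarrow> real"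
    assume uv: "\<forall>i<n. a \<le> u i \<and> u i \<le> v i \<and> v i \<le> b"
      and disj: "disjoint_family_on (\<lambda>i. {u i<..<v i}) {..<n}"
      and len: "(\<Sum>i<n. v i - u i) < min \<delta>1 \<delta>2"
    have "(\<Sum>i<n. norm (z (v i) - z (u i)))
        \<le> (\<Sum>i<n. K * (norm (x (v i) - x (u i)) + norm (y (v i) - y (u i))))"
      using uv by (intro sum_mono dom) auto
    also have "\<dots> = K * ((\<Sum>i<n. norm (x (v i) - x (u i))) + (\<Sum>i<n. norm (y (v i) - y (u i))))"
      by (simp add: sum_distrib_left sum.distrib distrib_left)
    also have "\<dots> \<le> K * (\<epsilon>' + \<epsilon>')"
      using 1(2)[rule_format, of n u v] 2(2)[rule_format, of n u v] uv disj len K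
      by (intro mult_left_mono add_mono) auto
    also have "\<dots> < \<epsilon>"
      unfolding twice using K \<open>0 < \<epsilon>\<close> by (simp add: field_simps)
    finally show "(\<Sum>i<n. norm (z (v i) - z (u i))) < \<epsilon>" .
  qed (use 1(1) 2(1) in auto)
qed

lemma abs_cont_on_lipschitz:
  assumes "0 \<le> L" "\<And>s t. a \<le> s \<Longrightarrow> s \<le> t \<Longrightarrow> t \<le> b \<Longrightarrow> norm (x t - x s) \<le> L * (t - s)"
  shows "abs_cont_on a b x"
  unfolding abs_cont_on_def
proof (intro allI impI)
  fix \<epsilon> :: real assume "0 < \<epsilon>"
  show "\<exists>\<delta>>0. \<forall>(n::nat) u v. (\<forall>i<n. a \<le> u i \<and> u i \<le> v i \<and> v i \<le> b) \<and>
     disjoint_family_on (\<lambda>i. {u i<..<v i}) {..<n} \<and> (\<Sum>i<n. v i - u i) < \<delta>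
     \<longrightarrow> (\<Sum>i<n. norm (x (v i) - x (u i))) < \<epsilon>"
  proof (intro exI[of _ "\<epsilon> / (L + 1)"] conjI allI impI; (elim conjE)?)
    fix n :: nat and u v :: "nat \<Rightarrow> real"
    assume uv: "\<forall>i<n. a \<le> u i \<and> u i \<le> v i \<and> v i \<le> b"
      and len: "(\<Sum>i<n. v i - u i) < \<epsilon> / (L + 1)"
    have "(\<Sum>i<n. norm (x (v i) - x (u i))) \<le> (\<Sum>i<n. L * (v i - u i))"
      using uv by (intro sum_mono assms(2)) auto
    also have "\<dots> = L * (\<Sum>i<n. v i - u i)" by (simp add: sum_distrib_left)
    also have "\<dots> \<le> L * (\<epsilon> / (L + 1))" using len assms(1) by (intro mult_left_mono) auto
    also have "\<dots> < \<epsilon>" using \<open>0 < \<epsilon>\<close> assms(1) by (simp add: field_simps)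
    finally show "(\<Sum>i<n. norm (x (v i) - x (u i))) < \<epsilon>" .
  qed (use \<open>0 < \<epsilon>\<close> assms(1) in auto)
qed

lemma abs_cont_on_const: "abs_cont_on a b (\<lambda>_. c)"
  by (rule abs_cont_on_lipschitz[of 0]) auto

lemma abs_cont_on_add:
  assumes "abs_cont_on a b x" "abs_cont_on a b y"
  shows "abs_cont_on a b (\<lambda>t. x t + y t)"
proof (rule abs_cont_on_dominated[OF assms, of 1])
  fix s t
  show "norm (x t + y t - (x s + y s)) \<le> 1 * (norm (x t - x s) + norm (y t - y s))"
    using norm_triangle_ineq[of "x t - x s" "y t - y s"] by (simp add: algebra_simps)
qed simp

lemma abs_cont_on_diff:
  assumes "abs_cont_on a b x" "abs_cont_on a b y"
  shows "abs_cont_on a b (\<lambda>t. x t - y t)"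
proof (rule abs_cont_on_dominated[OF assms, of 1])
  fix s t
  show "norm (x t - y t - (x s - y s)) \<le> 1 * (norm (x t - x s) + norm (y t - y s))"
    using norm_triangle_ineq4[of "x t - x s" "y t - y s"] by (simp add: algebra_simps)
qed simp

lemma abs_cont_on_sum:
  assumes "\<And>i. i \<in> I \<Longrightarrow> abs_cont_on a b (x i)"
  shows "abs_cont_on a b (\<lambda>t. \<Sum>i\<in>I. x i t)"
  using assms by (induction I rule: infinite_finite_induct)
    (auto intro: abs_cont_on_const abs_cont_on_add)

lemma abs_cont_on_cnj: "abs_cont_on a b x \<Longrightarrow> abs_cont_on a b (\<lambda>t. cnj (x t))"
  by (rule abs_cont_on_dominated[where x=x and y=x and K=1])
     (auto simp flip: complex_cnj_diff)

lemma abs_cont_on_imp_continuous_on: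
  assumes "abs_cont_on a b x"
  shows "continuous_on {a..b} x"
  unfolding continuous_on_iff
proof (intro ballI allI impI)
  fix t e :: real assume t: "t \<in> {a..b}" and "0 < e"
  obtain \<delta> where \<delta>: "0 < \<delta>" "\<forall>(n::nat) u v.
     (\<forall>i<n. a \<le> u i \<and> u i \<le> v i \<and> v i \<le> b) \<and>
     disjoint_family_on (\<lambda>i. {u i<..<v i}) {..<n} \<and> (\<Sum>i<n. v i - u i) < \<delta>
     \<longrightarrow> (\<Sum>i<n. norm (x (v i) - x (u i))) < e"
    using assms[unfolded abs_cont_on_def, rule_format, OF \<open>0 < e\<close>] by (elim exE conjE)
  have "dist (x s) (x t) < e" if "s \<in> {a..b}" "dist s t < \<delta>" for s
    \<comment> \<open>a family consisting of a single interval\<close>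
    using \<delta>(2)[rule_format, of 1 "\<lambda>_. min s t" "\<lambda>_. max s t"] that t
    by (cases "s \<le> t") (auto simp: dist_norm norm_minus_commute disjoint_family_on_def min_def max_def)
  then show "\<exists>d>0. \<forall>s\<in>{a..b}. dist s t < d \<longrightarrow> dist (x s) (x t) < e"
    using \<delta>(1) by blast
qed

lemma abs_cont_on_bounded:
  assumes "abs_cont_on a b x"
  obtains C where "0 \<le> C" "\<And>t. t \<in> {a..b} \<Longrightarrow> norm (x t) \<le> C"
proof -
  have "bounded (x ` {a..b})"
    using abs_cont_on_imp_continuous_on[OF assms]
    by (intro compact_imp_bounded compact_continuous_image) auto
  then obtain C where "0 < C" "\<forall>y\<in>x ` {a..b}. norm y \<le> C"
    unfolding bounded_pos by blast
  then show thesis by (intro that[of C]) auto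
qed

lemma abs_cont_on_mult:
  assumes x: "abs_cont_on a b x" and y: "abs_cont_on a b y"
  shows "abs_cont_on a b (\<lambda>t. x t * y t)"
proof -
  obtain C D where C: "0 \<le> C" "\<And>t. t \<in> {a..b} \<Longrightarrow> norm (x t) \<le> C"
    and D: "0 \<le> D" "\<And>t. t \<in> {a..b} \<Longrightarrow> norm (y t) \<le> D"
    using abs_cont_on_bounded[OF x] abs_cont_on_bounded[OF y] by metis
  show ?thesis
  proof (rule abs_cont_on_dominated[OF x y, of "C + D"])
    fix s t assume st: "a \<le> s" "s \<le> t" "t \<le> b"
    have "x t * y t - x s * y s = (x t - x s) * y t + x s * (y t - y s)"
      by (simp add: algebra_simps)
    then have "norm (x t * y t - x s * y s)
        \<le> norm (x t - x s) * norm (y t) + norm (x s) * norm (y t - y s)"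
      by (metis norm_mult norm_triangle_ineq)
    also have "\<dots> \<le> norm (x t - x s) * D + C * norm (y t - y s)"
      using C D st by (intro add_mono mult_mono) auto
    also have "\<dots> \<le> (C + D) * (norm (x t - x s) + norm (y t - y s))"
      using C(1) D(1) by (simp add: algebra_simps)
    finally show "norm (x t * y t - x s * y s)
        \<le> (C + D) * (norm (x t - x s) + norm (y t - y s))" .
  qed (use C D in auto)
qed

lemma abs_cont_on_exp:
  assumes "0 \<le> q"
  shows "abs_cont_on 0 T (\<lambda>t. complex_of_real (exp (q * t)))"
proof (rule abs_cont_on_lipschitz[of "q * exp (q * T)"])
  fix s t :: real assume st: "0 \<le> s" "s \<le> t" "t \<le> T"
  have "1 + (q * s - q * t) \<le> exp (q * s - q * t)" by (rule exp_ge_add_one_self)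
  then have "exp (q * t) * (1 + (q * s - q * t)) \<le> exp (q * t) * exp (q * s - q * t)"
    by (intro mult_left_mono) auto
  then have "exp (q * t) - exp (q * s) \<le> exp (q * t) * (q * (t - s))"
    by (simp add: exp_diff algebra_simps)
  also have "\<dots> \<le> exp (q * T) * (q * (t - s))"
    using st assms by (intro mult_right_mono) (auto intro: mult_left_mono)
  finally have "exp (q * t) - exp (q * s) \<le> q * exp (q * T) * (t - s)"
    by (simp add: algebra_simps)
  moreover have "exp (q * s) \<le> exp (q * t)" using st assms by (auto intro: mult_left_mono)
  ultimately show "norm (complex_of_real (exp (q * t)) - complex_of_real (exp (q * s)))
      \<le> q * exp (q * T) * (t - s)"
    by (simp flip: of_real_diff)
qed (use assms in auto)

text \<open>Gronwall's inequality for the squared norm \<open>\<sigma>\<close> of an absolutely continuous curve: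
  \<open>\<sigma>' \<le> 1 - q * \<sigma>\<close> almost everywhere says that \<open>exp (q * t) * (\<sigma> t - 1 / q)\<close> has a nonpositive
  derivative almost everywhere, and this function is absolutely continuous, being built from the
  coordinates by sums and products.\<close>

lemma sq_norm_exp_decay:
  fixes z :: "nat \<Rightarrow> real \<Rightarrow> complex"
  assumes q: "0 < q" and T: "0 \<le> T" and ac: "\<And>j. j < N \<Longrightarrow> abs_cont_on 0 T (z j)"
    and der: "AE t in lebesgue_on {0..T}. \<exists>z'.
      (\<forall>j<N. (z j has_vector_derivative z' j) (at t within {0..T})) \<and>
      2 * Re (\<Sum>j<N. z' j * cnj (z j t)) \<le> 1 - q * (\<Sum>j<N. (cmod (z j t))\<^sup>2)"
  shows "(\<Sum>j<N. (cmod (z j T))\<^sup>2) \<le> 1 / q + ((\<Sum>j<N. (cmod (z j 0))\<^sup>2) - 1 / q) * exp (- q * T)"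
proof -
  define \<sigma> where "\<sigma> t = (\<Sum>j<N. (cmod (z j t))\<^sup>2)" for t
  define G where "G t = complex_of_real (exp (q * t)) *
    ((\<Sum>j<N. z j t * cnj (z j t)) - complex_of_real (1 / q))" for t
  have G_Re: "Re (G t) = exp (q * t) * (\<sigma> t - 1 / q)" for t
  proof -
    have "G t = complex_of_real (exp (q * t) * (\<sigma> t - 1 / q))"
      unfolding G_def \<sigma>_def by (simp add: complex_norm_square flip: of_real_power)
    then show ?thesis by simp
  qed
  have "Re (G T) \<le> Re (G 0)"
  proof (rule abs_cont_decreasing[OF T])
    show "abs_cont_on 0 T G" unfolding G_def
      by (intro abs_cont_on_mult abs_cont_on_exp abs_cont_on_diff abs_cont_on_sum abs_cont_on_const
          abs_cont_on_cnj ac) (use q in auto)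
    show "AE t in lebesgue_on {0..T}.
        \<exists>D. (G has_vector_derivative D) (at t within {0..T}) \<and> Re D \<le> 0"
      using der
    proof eventually_elim
      fix t assume "\<exists>z'. (\<forall>j<N. (z j has_vector_derivative z' j) (at t within {0..T})) \<and>
        2 * Re (\<Sum>j<N. z' j * cnj (z j t)) \<le> 1 - q * (\<Sum>j<N. (cmod (z j t))\<^sup>2)"
      then obtain z' where z': "\<And>j. j < N \<Longrightarrow> (z j has_vector_derivative z' j) (at t within {0..T})"
        and diss: "2 * Re (\<Sum>j<N. z' j * cnj (z j t)) \<le> 1 - q * \<sigma> t"
        unfolding \<sigma>_def by blast
      define D where "D = complex_of_real (exp (q * t)) *
          (\<Sum>j<N. z j t * cnj (z' j) + z' j * cnj (z j t)) + complex_of_real (q * exp (q * t)) *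
          ((\<Sum>j<N. z j t * cnj (z j t)) - complex_of_real (1 / q))"
      have e: "((\<lambda>t. complex_of_real (exp (q * t))) has_vector_derivative
          complex_of_real (q * exp (q * t))) (at t within {0..T})"
        unfolding has_vector_derivative_complex_iff
        by (auto intro!: derivative_eq_intros)
      have s: "((\<lambda>t. (\<Sum>j<N. z j t * cnj (z j t)) - complex_of_real (1 / q)) has_vector_derivative
          (\<Sum>j<N. z j t * cnj (z' j) + z' j * cnj (z j t)) - 0) (at t within {0..T})"
        by (intro has_vector_derivative_diff has_vector_derivative_sum has_vector_derivative_mult
            has_vector_derivative_cnj z' has_vector_derivative_const) auto
      have "(G has_vector_derivative D) (at t within {0..T})"
        using has_vector_derivative_mult[OF e s] unfolding G_def D_def by simp
      moreover have "Re D = exp (q * t) * (2 * Re (\<Sum>j<N. z' j * cnj (z j t)) + q * \<sigma> t - 1)"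
      proof -
        have "Re (\<Sum>j<N. z j t * cnj (z' j) + z' j * cnj (z j t)) = 2 * Re (\<Sum>j<N. z' j * cnj (z j t))"
          by (simp add: sum_distrib_left algebra_simps)
        moreover have "(\<Sum>j<N. z j t * cnj (z j t)) = complex_of_real (\<sigma> t)"
          unfolding \<sigma>_def by (simp add: complex_norm_square flip: of_real_power)
        ultimately show ?thesis
          using q unfolding D_def by (simp add: field_simps)
      qed
      moreover have "\<dots> \<le> 0"
        using diss by (intro mult_nonneg_nonpos) auto
      ultimately show "\<exists>D. (G has_vector_derivative D) (at t within {0..T}) \<and> Re D \<le> 0" by auto
    qed
  qed
  then have "exp (q * T) * (\<sigma> T - 1 / q) \<le> \<sigma> 0 - 1 / q"
    by (simp add: G_Re)
  then have "\<sigma> T - 1 / q \<le> (\<sigma> 0 - 1 / q) * exp (- q * T)"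
    by (simp add: exp_minus field_simps)
  then show ?thesis unfolding \<sigma>_def by simp
qed

section \<open>Quadratic forms of Hermitian matrices\<close>

text \<open>The real part turns the sesquilinear product into a symmetric real bilinear form with
  the same squared norm. All estimates concern real parts only, so symmetry replaces conjugation
  throughout.\<close>

definition rinner :: "complex vec \<Rightarrow> complex vec \<Rightarrow> real" where
  "rinner v w = Re (v \<bullet>c w)"

lemma rinner_eq_sum:
  assumes "v \<in> carrier_vec n" "w \<in> carrier_vec n"
  shows "rinner v w = Re (\<Sum>j<n. v $ j * cnj (w $ j))"
  using assms by (auto simp: rinner_def scalar_prod_def lessThan_atLeast0 intro!: arg_cong[where f=Re] sum.cong)

lemma rinner_self_eq_sum:
  assumes "v \<in> carrier_vec n"
  shows "rinner v v = (\<Sum>j<n. (cmod (v $ j))\<^sup>2)"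
  unfolding rinner_eq_sum[OF assms assms] by (simp add: cmod_def flip: power2_eq_square)

lemma rinner_self_nonneg: "0 \<le> rinner v v"
  using rinner_self_eq_sum[of v "dim_vec v"] by (simp add: sum_nonneg)

lemma rinner_self_pos:
  assumes "v \<in> carrier_vec n" "v \<noteq> 0\<^sub>v n"
  shows "0 < rinner v v"
proof -
  obtain i where "i < n" "v $ i \<noteq> 0"
    using assms by (metis carrier_vecD eq_vecI index_zero_vec)
  then have "0 < (\<Sum>j<n. (cmod (v $ j))\<^sup>2)"
    by (intro sum_pos2[of _ i]) auto
  then show ?thesis using rinner_self_eq_sum[OF assms(1)] by simp
qed

lemma rinner_commute:
  assumes "v \<in> carrier_vec n" "w \<in> carrier_vec n"
  shows "rinner v w = rinner w v"
  unfolding rinner_eq_sum[OF assms] rinner_eq_sum[OF assms(2,1)]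
  by (simp add: algebra_simps)

lemma rinner_add_left:
  assumes "u \<in> carrier_vec n" "v \<in> carrier_vec n" "w \<in> carrier_vec n"
  shows "rinner (u + v) w = rinner u w + rinner v w"
  using assms by (simp add: rinner_def add_scalar_prod_distrib[where n=n])

lemma rinner_diff_left:
  assumes "u \<in> carrier_vec n" "v \<in> carrier_vec n" "w \<in> carrier_vec n"
  shows "rinner (u - v) w = rinner u w - rinner v w"
  using assms by (simp add: rinner_def minus_scalar_prod_distrib[where n=n])

lemma rinner_diff_right:
  assumes "u \<in> carrier_vec n" "v \<in> carrier_vec n" "w \<in> carrier_vec n"
  shows "rinner u (v - w) = rinner u v - rinner u w"
  using assms rinner_diff_left[of v n w u] rinner_commute[of u n] by simp

lemma rinner_uminus_right:
  assumes "u \<in> carrier_vec n" "v \<in> carrier_vec n"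
  shows "rinner u (- v) = - rinner u v"
  using assms by (simp add: rinner_eq_sum[where n=n] sum_negf)

lemma rinner_smult_left:
  assumes "u \<in> carrier_vec n" "v \<in> carrier_vec n"
  shows "rinner (complex_of_real r \<cdot>\<^sub>v u) v = r * rinner u v"
  using assms by (simp add: rinner_def)

lemma rinner_smult_right:
  assumes "u \<in> carrier_vec n" "v \<in> carrier_vec n"
  shows "rinner u (complex_of_real r \<cdot>\<^sub>v v) = r * rinner u v"
  using assms rinner_smult_left[of v n u r] rinner_commute[of u n] by simp

lemma rinner_young:
  assumes "u \<in> carrier_vec n" "v \<in> carrier_vec n"
  shows "2 * rinner u v \<le> rinner u u + rinner v v"
  using rinner_self_nonneg[of "u - v"] assms rinner_commute[OF assms]
  by (simp add: rinner_diff_left[where n=n] rinner_diff_right[where n=n])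

lemma mat_adjoint_carrier [simp]:
  "A \<in> carrier_mat nr nc \<Longrightarrow> mat_adjoint A \<in> carrier_mat nc nr"
  unfolding mat_adjoint_def by (auto simp: mat_of_rows_def)

lemma mat_adjoint_index:
  assumes "A \<in> carrier_mat nr nc" "i < nc" "j < nr"
  shows "mat_adjoint A $$ (i, j) = cnj (A $$ (j, i))"
  using assms unfolding mat_adjoint_def by (simp add: mat_of_rows_index)

lemma mult_mat_vec_index_sum:
  assumes "A \<in> carrier_mat nr nc" "v \<in> carrier_vec nc" "i < nr"
  shows "(A *\<^sub>v v) $ i = (\<Sum>j<nc. A $$ (i, j) * v $ j)"
  using assms by (auto simp: scalar_prod_def lessThan_atLeast0)

lemma rinner_adjoint:
  assumes A: "A \<in> carrier_mat nr nc" and v: "v \<in> carrier_vec nc" and w: "w \<in> carrier_vec nr"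
  shows "rinner (A *\<^sub>v v) w = rinner v (mat_adjoint A *\<^sub>v w)"
proof -
  have "(\<Sum>i<nr. (A *\<^sub>v v) $ i * cnj (w $ i)) = (\<Sum>i<nr. \<Sum>j<nc. A $$ (i, j) * v $ j * cnj (w $ i))"
    by (intro sum.cong refl) (simp add: mult_mat_vec_index_sum[OF A v] sum_distrib_right)
  also have "\<dots> = (\<Sum>j<nc. \<Sum>i<nr. A $$ (i, j) * v $ j * cnj (w $ i))"
    by (rule sum.swap)
  also have "\<dots> = (\<Sum>j<nc. v $ j * cnj ((mat_adjoint A *\<^sub>v w) $ j))"
    by (intro sum.cong refl)
       (simp add: mult_mat_vec_index_sum[OF mat_adjoint_carrier[OF A] w] mat_adjoint_index[OF A]
         sum_distrib_left mult_ac)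
  finally show ?thesis
    using rinner_eq_sum[OF mult_mat_vec_carrier[OF A v] w]
      rinner_eq_sum[OF v mult_mat_vec_carrier[OF mat_adjoint_carrier[OF A] w]] by simp
qed

lemma rinner_mult_mat_vec_bounded:
  assumes A: "A \<in> carrier_mat m n"
  obtains K where "0 < K"
    "\<And>v. v \<in> carrier_vec n \<Longrightarrow> rinner (A *\<^sub>v v) (A *\<^sub>v v) \<le> K * rinner v v"
proof -
  define r where "r i = (\<Sum>j<n. cmod (A $$ (i, j)))" for i
  define K where "K = (\<Sum>i<m. (r i)\<^sup>2) + 1"
  have "0 < K" unfolding K_def by (simp add: add_nonneg_pos sum_nonneg)
  moreover have "rinner (A *\<^sub>v v) (A *\<^sub>v v) \<le> K * rinner v v" if v: "v \<in> carrier_vec n" for v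
  proof -
    define s where "s = sqrt (rinner v v)"
    have s: "0 \<le> s" "s\<^sup>2 = rinner v v" using rinner_self_nonneg by (auto simp: s_def)
    have vj: "cmod (v $ j) \<le> s" if "j < n" for j
    proof -
      have "(cmod (v $ j))\<^sup>2 \<le> (\<Sum>j<n. (cmod (v $ j))\<^sup>2)"
        using that by (intro member_le_sum) auto
      then show ?thesis
        unfolding s_def rinner_self_eq_sum[OF v] by (rule real_le_rsqrt)
    qed
    have row: "(cmod ((A *\<^sub>v v) $ i))\<^sup>2 \<le> (r i)\<^sup>2 * rinner v v" if "i < m" for i
    proof -
      have "cmod ((A *\<^sub>v v) $ i) \<le> (\<Sum>j<n. cmod (A $$ (i, j)) * s)"
        unfolding mult_mat_vec_index_sum[OF A v that]
        by (intro sum_norm_le) (auto simp: norm_mult intro!: mult_left_mono vj)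
      then have "cmod ((A *\<^sub>v v) $ i) \<le> r i * s" by (simp add: r_def sum_distrib_right)
      then have "(cmod ((A *\<^sub>v v) $ i))\<^sup>2 \<le> (r i * s)\<^sup>2" by (intro power_mono) auto
      then show ?thesis by (simp add: power_mult_distrib s)
    qed
    have "rinner (A *\<^sub>v v) (A *\<^sub>v v) \<le> (\<Sum>i<m. (r i)\<^sup>2 * rinner v v)"
      unfolding rinner_self_eq_sum[OF mult_mat_vec_carrier[OF A v]]
      by (intro sum_mono row) auto
    also have "\<dots> \<le> K * rinner v v"
      using rinner_self_nonneg[of v] by (simp add: K_def sum_distrib_right distrib_right)
    finally show ?thesis .
  qed
  ultimately show thesis by (rule that)
qed

lemma rinner_quadratic_form_bounded:
  assumes A: "A \<in> carrier_mat n n"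
  obtains c where "0 < c" "\<And>v. v \<in> carrier_vec n \<Longrightarrow> rinner (A *\<^sub>v v) v \<le> c * rinner v v"
proof -
  obtain K where K: "0 < K"
    "\<And>v. v \<in> carrier_vec n \<Longrightarrow> rinner (A *\<^sub>v v) (A *\<^sub>v v) \<le> K * rinner v v"
    using rinner_mult_mat_vec_bounded[OF A] by blast
  have "rinner (A *\<^sub>v v) v \<le> ((K + 1) / 2) * rinner v v" if v: "v \<in> carrier_vec n" for v
    using rinner_young[OF mult_mat_vec_carrier[OF A v] v] K(2)[OF v]
    by (simp add: field_simps)
  with K(1) show thesis by (intro that[of "(K + 1) / 2"]) auto
qed

text \<open>Evaluate the nonnegative form at \<open>v - (1 / c) X v\<close>: this choice minimises the upper
  bound \<open>(X v, v) - 2 s \<parallel>X v\<parallel>\<^sup>2 + s\<^sup>2 c \<parallel>X v\<parallel>\<^sup>2\<close> over the steps \<open>s\<close>.\<close>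

lemma psd_image_bound:
  assumes X: "X \<in> carrier_mat n n" "mat_adjoint X = X"
    and psd: "\<And>z. z \<in> carrier_vec n \<Longrightarrow> 0 \<le> rinner (X *\<^sub>v z) z"
    and c: "0 < c" "\<And>z. z \<in> carrier_vec n \<Longrightarrow> rinner (X *\<^sub>v z) z \<le> c * rinner z z"
    and v: "v \<in> carrier_vec n"
  shows "rinner (X *\<^sub>v v) (X *\<^sub>v v) \<le> c * rinner (X *\<^sub>v v) v"
proof -
  define y where "y = X *\<^sub>v v"
  define s where "s = complex_of_real (1 / c)"
  have y: "y \<in> carrier_vec n" "X *\<^sub>v y \<in> carrier_vec n" using X v by (auto simp: y_def)
  have Xz: "X *\<^sub>v (v - s \<cdot>\<^sub>v y) = y - s \<cdot>\<^sub>v (X *\<^sub>v y)"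
    using X v y by (simp add: mult_minus_distrib_mat_vec[OF X(1)] mult_mat_vec[OF X(1)] y_def)
  have "0 \<le> rinner (X *\<^sub>v (v - s \<cdot>\<^sub>v y)) (v - s \<cdot>\<^sub>v y)"
    using v y by (intro psd) auto
  also have "\<dots> = rinner y v - 1 / c * rinner y y - 1 / c * rinner (X *\<^sub>v y) v
      + 1 / c * (1 / c * rinner (X *\<^sub>v y) y)"
    unfolding Xz using v y
    by (simp add: s_def rinner_diff_left[where n=n] rinner_diff_right[where n=n]
        rinner_smult_left[where n=n] rinner_smult_right[where n=n] right_diff_distrib
        del: of_real_divide)
  also have "rinner (X *\<^sub>v y) v = rinner y y"
    using rinner_adjoint[OF X(1) y(1) v] X(2) by (simp add: y_def)
  also have "1 / c * (1 / c * rinner (X *\<^sub>v y) y) \<le> 1 / c * rinner y y"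
    using c(1) c(2)[OF y(1)] by (intro mult_left_mono) (auto simp: field_simps)
  finally have "1 / c * rinner y y \<le> rinner y v" by simp
  then show ?thesis using c(1) by (simp add: y_def field_simps)
qed

lemma inverse_of_injective_mat:
  fixes X :: "complex mat"
  assumes X: "X \<in> carrier_mat n n"
    and inj: "\<And>v. v \<in> carrier_vec n \<Longrightarrow> X *\<^sub>v v = 0\<^sub>v n \<Longrightarrow> v = 0\<^sub>v n"
  obtains Y where "mat_inverse X = Some Y" "Y \<in> carrier_mat n n" "X * Y = 1\<^sub>m n" "Y * X = 1\<^sub>m n"
proof -
  have "det X \<noteq> 0"
    using det_0_iff_vec_prod_zero_field[OF X] inj by auto
  then have "X \<in> Units (ring_mat TYPE(complex) n ())"
    by (rule det_non_zero_imp_unit[OF X])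
  then obtain Y where "mat_inverse X = Some Y"
    using mat_inverse(1)[OF X, where b="()"] by (cases "mat_inverse X") auto
  then show thesis using mat_inverse(2)[OF X] that by blast
qed

lemma eigenvalue_rinner:
  assumes X: "X \<in> carrier_mat n n" and "eigenvalue X (complex_of_real r)"
  obtains v where "v \<in> carrier_vec n" "0 < rinner v v" "rinner (X *\<^sub>v v) v = r * rinner v v"
proof -
  obtain v where v: "v \<in> carrier_vec n" "v \<noteq> 0\<^sub>v n" "X *\<^sub>v v = complex_of_real r \<cdot>\<^sub>v v"
    using assms unfolding eigenvalue_def eigenvector_def by auto
  then show thesis
    using rinner_self_pos[OF v(1,2)] by (intro that[of v]) (auto simp: rinner_smult_left[where n=n])
qed

lemma finite_real_eigenvalues:
  assumes "(X :: complex mat) \<in> carrier_mat n n"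
  shows "finite {r. eigenvalue X (complex_of_real r)}"
proof -
  have "finite {k. eigenvalue X k}"
  proof -
    have "char_poly X \<noteq> 0" using degree_monic_char_poly[OF assms] by auto
    then show ?thesis
      using poly_roots_finite eigenvalue_root_char_poly[OF assms] by simp
  qed
  then have "finite (complex_of_real -` {k. eigenvalue X k})"
    by (rule finite_vimageI) (simp add: inj_of_real)
  then show ?thesis by (simp add: vimage_def)
qed

text \<open>The supremum \<open>t\<close> of the Rayleigh quotient is an eigenvalue of \<open>X\<close>, hence at most
  the largest one. Otherwise the positive semidefinite matrix
  \<open>Y = t I - X\<close> has an inverse \<open>Z\<close>, and \<open>\<parallel>z\<parallel>\<^sup>2 = \<parallel>Z Y z\<parallel>\<^sup>2 \<le> K \<parallel>Y z\<parallel>\<^sup>2 \<le> K c (Y z, z)\<close> would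
  bound the Rayleigh quotient of \<open>X\<close> by \<open>t - 1 / (K c) < t\<close>.\<close>

lemma rinner_le_max_eigval:
  assumes X: "X \<in> carrier_mat n n" "mat_adjoint X = X" and v: "v \<in> carrier_vec n"
  shows "rinner (X *\<^sub>v v) v \<le> max_eigval X * rinner v v"
proof (cases "v = 0\<^sub>v n")
  case True
  then show ?thesis using X by (simp add: rinner_eq_sum[where n=n])
next
  case False
  define Rq where "Rq = {rinner (X *\<^sub>v z) z / rinner z z | z. z \<in> carrier_vec n \<and> z \<noteq> 0\<^sub>v n}"
  define t where "t = Sup Rq"
  have ne: "Rq \<noteq> {}" using v False by (auto simp: Rq_def)
  obtain k where k: "\<And>z. z \<in> carrier_vec n \<Longrightarrow> rinner (X *\<^sub>v z) z \<le> k * rinner z z"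
    using rinner_quadratic_form_bounded[OF X(1)] by blast
  have "bdd_above Rq"
    unfolding Rq_def using k rinner_self_pos by (intro bdd_aboveI[of _ k]) (auto simp: divide_le_eq)
  then have upper: "rinner (X *\<^sub>v z) z \<le> t * rinner z z" if z: "z \<in> carrier_vec n" for z
  proof (cases "z = 0\<^sub>v n")
    case True
    then show ?thesis using X by (simp add: rinner_eq_sum[where n=n])
  next
    case False
    then have "rinner (X *\<^sub>v z) z / rinner z z \<le> t"
      unfolding t_def using z \<open>bdd_above Rq\<close> by (intro cSup_upper) (auto simp: Rq_def)
    then show ?thesis using rinner_self_pos[OF z False] by (simp add: divide_le_eq)
  qed
  have "eigenvalue X (complex_of_real t)"
  proof (rule ccontr)
    assume not_ev: "\<not> eigenvalue X (complex_of_real t)"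
    define Y where "Y = complex_of_real t \<cdot>\<^sub>m 1\<^sub>m n - X"
    have Y: "Y \<in> carrier_mat n n" unfolding Y_def using X by (intro minus_carrier_mat) auto
    have Yz: "Y *\<^sub>v z = complex_of_real t \<cdot>\<^sub>v z - X *\<^sub>v z" if "z \<in> carrier_vec n" for z
      using X that unfolding Y_def
      by (subst minus_mult_distrib_mat_vec[where nr=n and nc=n]) auto
    have Y_form: "rinner (Y *\<^sub>v z) z = t * rinner z z - rinner (X *\<^sub>v z) z" if "z \<in> carrier_vec n" for z
      using that X by (simp add: Yz rinner_diff_left[where n=n] rinner_smult_left[where n=n])
    have Y_adj: "mat_adjoint Y = Y"
    proof (rule eq_matI)
      fix i j assume "i < dim_row Y" "j < dim_col Y"
      then have ij: "i < n" "j < n" using Y by auto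
      have "cnj (X $$ (j, i)) = X $$ (i, j)"
        using mat_adjoint_index[OF X(1), of i j] ij X(2) by simp
      then show "mat_adjoint Y $$ (i, j) = Y $$ (i, j)"
        using ij X(1) unfolding mat_adjoint_index[OF Y ij] by (auto simp: Y_def)
    qed (use carrier_matD[OF Y] carrier_matD[OF mat_adjoint_carrier[OF Y]] in simp_all)
    have "z = 0\<^sub>v n" if "z \<in> carrier_vec n" "Y *\<^sub>v z = 0\<^sub>v n" for z
    proof (rule ccontr)
      assume "z \<noteq> 0\<^sub>v n"
      have "X *\<^sub>v z = complex_of_real t \<cdot>\<^sub>v z"
      proof (rule eq_vecI)
        fix i assume "i < dim_vec (complex_of_real t \<cdot>\<^sub>v z)"
        then have "i < n" using that by simp
        then show "(X *\<^sub>v z) $ i = (complex_of_real t \<cdot>\<^sub>v z) $ i"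
          using arg_cong[OF that(2)[unfolded Yz[OF that(1)]], of "\<lambda>v. v $ i"] X that(1)
          by simp
      qed (use X that in auto)
      with \<open>z \<noteq> 0\<^sub>v n\<close> that(1) X not_ev show False
        unfolding eigenvalue_def eigenvector_def by auto
    qed
    then obtain Z where Z: "Z \<in> carrier_mat n n" "Z * Y = 1\<^sub>m n"
      using inverse_of_injective_mat[OF Y] by blast
    obtain K where K: "0 < K"
      "\<And>z. z \<in> carrier_vec n \<Longrightarrow> rinner (Z *\<^sub>v z) (Z *\<^sub>v z) \<le> K * rinner z z"
      using rinner_mult_mat_vec_bounded[OF Z(1)] by blast
    obtain c where c: "0 < c" "\<And>z. z \<in> carrier_vec n \<Longrightarrow> rinner (Y *\<^sub>v z) z \<le> c * rinner z z"
      using rinner_quadratic_form_bounded[OF Y] by blast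
    have "rinner (X *\<^sub>v z) z / rinner z z \<le> t - 1 / (K * c)"
      if z: "z \<in> carrier_vec n" "z \<noteq> 0\<^sub>v n" for z
    proof -
      have "z = Z *\<^sub>v (Y *\<^sub>v z)"
        using assoc_mult_mat_vec[OF Z(1) Y z(1)] Z(2) z(1) by simp
      then have "rinner z z \<le> K * rinner (Y *\<^sub>v z) (Y *\<^sub>v z)"
        using K(2)[OF mult_mat_vec_carrier[OF Y z(1)]] by simp
      also have "\<dots> \<le> K * (c * rinner (Y *\<^sub>v z) z)"
        using K(1) upper Y_form c z
        by (intro mult_left_mono psd_image_bound[OF Y Y_adj]) auto
      finally have "rinner z z \<le> K * c * (t * rinner z z - rinner (X *\<^sub>v z) z)"
        using Y_form[OF z(1)] by simp
      then show ?thesis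
        using rinner_self_pos[OF z] K(1) c(1) by (simp add: field_simps)
    qed
    then have "t \<le> t - 1 / (K * c)"
      using cSup_least[OF ne] unfolding t_def[symmetric] by (fastforce simp: Rq_def)
    moreover have "0 < 1 / (K * c)" using K(1) c(1) by simp
    ultimately show False by linarith
  qed
  then have "t \<le> max_eigval X"
    unfolding max_eigval_def using finite_real_eigenvalues[OF X(1)] by (intro Max_ge) auto
  then show ?thesis
    using upper[OF v] rinner_self_nonneg[of v] by (meson mult_right_mono order_trans)
qed

lemma pos_defD:
  assumes "pos_def n X"
  shows "X \<in> carrier_mat n n" "mat_adjoint X = X"
    "v \<in> carrier_vec n \<Longrightarrow> v \<noteq> 0\<^sub>v n \<Longrightarrow> 0 < rinner (X *\<^sub>v v) v"
    "v \<in> carrier_vec n \<Longrightarrow> 0 \<le> rinner (X *\<^sub>v v) v"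
proof -
  show X: "X \<in> carrier_mat n n" "mat_adjoint X = X"
    and pos: "v \<in> carrier_vec n \<Longrightarrow> v \<noteq> 0\<^sub>v n \<Longrightarrow> 0 < rinner (X *\<^sub>v v) v"
    using assms by (auto simp: pos_def_def rinner_def)
  show "v \<in> carrier_vec n \<Longrightarrow> 0 \<le> rinner (X *\<^sub>v v) v"
    using pos X by (cases "v = 0\<^sub>v n") (auto simp: rinner_eq_sum[where n=n])
qed

text \<open>With \<open>v = X g\<close> the form of the inverse matrix becomes the form of \<open>X\<close> itself, so that
  inverses disappear from the estimates below.\<close>

lemma inv_form_preimage:
  assumes X: "pos_def n X" and v: "v \<in> carrier_vec n"
  obtains g where "g \<in> carrier_vec n" "X *\<^sub>v g = v" "inv_form X v = rinner (X *\<^sub>v g) g"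
proof -
  note XD = pos_defD[OF X]
  have "z = 0\<^sub>v n" if "z \<in> carrier_vec n" "X *\<^sub>v z = 0\<^sub>v n" for z
    using XD(3)[OF that(1)] that by (cases "z = 0\<^sub>v n") (auto simp: rinner_eq_sum[where n=n])
  then obtain Y where Y: "mat_inverse X = Some Y" "Y \<in> carrier_mat n n" "X * Y = 1\<^sub>m n"
    using inverse_of_injective_mat[OF XD(1)] by blast
  define g where "g = Y *\<^sub>v v"
  have g: "g \<in> carrier_vec n" using Y v by (simp add: g_def)
  have Xg: "X *\<^sub>v g = v"
    using assoc_mult_mat_vec[OF XD(1) Y(2) v] Y(3) v by (simp add: g_def)
  have "inv_form X v = rinner g v" by (simp add: inv_form_def Y(1) g_def rinner_def)
  also have "\<dots> = rinner (X *\<^sub>v g) g" using rinner_commute[OF g v] Xg by simp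
  finally show thesis using that g Xg by blast
qed

lemma inv_form_nonneg:
  assumes "pos_def n X" "v \<in> carrier_vec n"
  shows "0 \<le> inv_form X v"
  using inv_form_preimage[OF assms] pos_defD(4)[OF assms(1)] by metis

text \<open>Expand \<open>(X (g - z), g - z) \<ge> 0\<close> for \<open>v = X g\<close>.\<close>

lemma inv_form_young:
  assumes X: "pos_def n X" and v: "v \<in> carrier_vec n" and z: "z \<in> carrier_vec n"
  shows "2 * rinner v z \<le> inv_form X v + rinner (X *\<^sub>v z) z"
proof -
  note XD = pos_defD[OF X]
  obtain g where g: "g \<in> carrier_vec n" "X *\<^sub>v g = v" "inv_form X v = rinner (X *\<^sub>v g) g"
    using inv_form_preimage[OF X v] by blast
  have c: "X *\<^sub>v z \<in> carrier_vec n" using XD(1) z by simp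
  have "0 \<le> rinner (X *\<^sub>v (g - z)) (g - z)" using XD(4) g z by simp
  also have "X *\<^sub>v (g - z) = v - X *\<^sub>v z"
    using g z mult_minus_distrib_mat_vec[OF XD(1)] by simp
  also have "rinner (v - X *\<^sub>v z) (g - z)
      = rinner v g - rinner v z - rinner (X *\<^sub>v z) g + rinner (X *\<^sub>v z) z"
    using g z v c by (simp add: rinner_diff_left[where n=n] rinner_diff_right[where n=n])
  also have "rinner (X *\<^sub>v z) g = rinner v z"
    using rinner_adjoint[OF XD(1) z g(1)] XD(2) g v z rinner_commute[OF v z] by simp
  finally show ?thesis using g by simp
qed

text \<open>For \<open>v = X g\<close> this is \<open>\<parallel>X g\<parallel>\<^sup>2 \<le> c (X g, g)\<close> with the largest eigenvalue as the upper
  bound \<open>c\<close> of the form.\<close>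

lemma rinner_self_le_max_eigval_inv_form:
  assumes X: "pos_def n X" and v: "v \<in> carrier_vec n"
  shows "rinner v v \<le> max_eigval X * inv_form X v"
proof (cases "v = 0\<^sub>v n")
  case True
  obtain g where "g \<in> carrier_vec n" "X *\<^sub>v g = v" "inv_form X v = rinner (X *\<^sub>v g) g"
    using inv_form_preimage[OF X v] by blast
  then show ?thesis using True by (simp add: rinner_eq_sum[where n=n])
next
  case False
  note XD = pos_defD[OF X]
  obtain g where g: "g \<in> carrier_vec n" "X *\<^sub>v g = v" "inv_form X v = rinner (X *\<^sub>v g) g"
    using inv_form_preimage[OF X v] by blast
  note le = rinner_le_max_eigval[OF XD(1,2)]
  have "0 < max_eigval X * rinner v v" using XD(3)[OF v False] le[OF v] by linarith
  then have "0 < max_eigval X" using rinner_self_nonneg[of v] by (simp add: zero_less_mult_iff)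
  then have "rinner (X *\<^sub>v g) (X *\<^sub>v g) \<le> max_eigval X * rinner (X *\<^sub>v g) g"
    using XD le g by (intro psd_image_bound) auto
  then show ?thesis using g by simp
qed

lemma max_eigval_nonneg:
  assumes "pos_def n X" "0 < n"
  shows "0 \<le> max_eigval X"
proof -
  let ?u = "unit_vec n 0 :: complex vec"
  have u: "?u \<in> carrier_vec n" "?u \<noteq> 0\<^sub>v n" using assms(2) by (auto simp: unit_vec_nonzero)
  have "0 \<le> rinner (X *\<^sub>v ?u) ?u" using pos_defD(4)[OF assms(1) u(1)] .
  also have "\<dots> \<le> max_eigval X * rinner ?u ?u"
    by (rule rinner_le_max_eigval[OF pos_defD(1,2)[OF assms(1)] u(1)])
  finally show ?thesis using rinner_self_pos[OF u] by (simp add: zero_le_mult_iff)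
qed

section \<open>Convection and diffusion matrices\<close>

lemma div_mod_of_digits: "b < m \<Longrightarrow> (a * m + b) div m = a \<and> (a * m + b) mod m = (b::nat)"
  by simp

lemma mode_reflect:
  assumes "even N1" "even N2" "k < n_modes N1 N2"
  shows "mode N1 N2 (n_modes N1 N2 - Suc k) = (- fst (mode N1 N2 k), - snd (mode N1 N2 k))"
proof -
  define a b where "a = k div (N2 + 1)" and "b = k mod (N2 + 1)"
  have k: "k = a * (N2 + 1) + b" by (simp only: a_def b_def div_mult_mod_eq)
  have b: "b \<le> N2" unfolding b_def by (metis Suc_eq_plus1 less_Suc_eq_le mod_less_divisor zero_less_Suc)
  have a: "a \<le> N1"
    using assms(3) unfolding a_def n_modes_def
    by (metis Suc_eq_plus1 less_Suc_eq_le less_mult_imp_div_less)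
  obtain a' b' where a': "N1 = a + a'" and b': "N2 = b + b'"
    using a b by (metis le_iff_add)
  have "n_modes N1 N2 - Suc k = a' * (N2 + 1) + b'"
    unfolding n_modes_def k a' b' by (simp add: algebra_simps)
  then have "(n_modes N1 N2 - Suc k) div (N2 + 1) = a'" "(n_modes N1 N2 - Suc k) mod (N2 + 1) = b'"
    using div_mod_of_digits[of b' "N2 + 1" a'] b' by simp_all
  moreover obtain c d where cd: "N1 = 2 * c" "N2 = 2 * d" using assms(1,2) by (auto elim!: evenE)
  moreover have "int a' = 2 * int c - int a" "int b' = 2 * int d - int b"
    using a' b' cd by linarith+
  ultimately show ?thesis
    unfolding mode_def a_def[symmetric] b_def[symmetric] by simp
qed

lemma mode_eq_zero_iff:
  assumes "even N1" "even N2"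
  shows "mode N1 N2 k = (0, 0) \<longleftrightarrow> k = (n_modes N1 N2 - 1) div 2"
proof -
  obtain a b where ab: "N1 = 2 * a" "N2 = 2 * b" using assms by (auto elim!: evenE)
  have mid: "(n_modes N1 N2 - 1) div 2 = a * (N2 + 1) + b"
    by (simp add: n_modes_def ab algebra_simps)
  have "mode N1 N2 k = (0, 0) \<longleftrightarrow> k div (N2 + 1) = a \<and> k mod (N2 + 1) = b"
    by (simp add: mode_def ab)
  also have "\<dots> \<longleftrightarrow> k = a * (N2 + 1) + b"
  proof
    assume "k div (N2 + 1) = a \<and> k mod (N2 + 1) = b"
    then show "k = a * (N2 + 1) + b" by (metis div_mult_mod_eq)
  next
    assume "k = a * (N2 + 1) + b"
    then show "k div (N2 + 1) = a \<and> k mod (N2 + 1) = b"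
      using div_mod_of_digits[of b "N2 + 1" a] ab by simp
  qed
  finally show ?thesis using mid by simp
qed

lemma n_modes_odd: "even N1 \<Longrightarrow> even N2 \<Longrightarrow> odd (n_modes N1 N2)"
  by (simp add: n_modes_def)

text \<open>The coefficient with which the mode of index \<open>k\<close> of the velocity couples the modes of
  indices \<open>i\<close> and \<open>j\<close>. It is real, and it vanishes if \<open>k\<close> is the index of the mode \<open>(0, 0)\<close>, so
  that the convection matrix becomes a sum over all modes which is visibly linear in the vorticity.\<close>

definition interaction :: "nat \<Rightarrow> nat \<Rightarrow> real \<Rightarrow> real \<Rightarrow> nat \<Rightarrow> nat \<Rightarrow> nat \<Rightarrow> real" where
  "interaction N1 N2 Lx Ly i j k =
     (let (c, d) = mode N1 N2 i; (n, m) = mode N1 N2 j; (p, q) = mode N1 N2 k in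
      if (p, q) \<noteq> (0, 0) \<and> p + n = c \<and> q + m = d
      then - (of_int (p * m - q * n) * Lx * Ly / ((of_int p)\<^sup>2 * Ly\<^sup>2 + (of_int q)\<^sup>2 * Lx\<^sup>2))
      else 0)"

lemma convection_mat_carrier [simp]:
  "convection_mat N1 N2 Lx Ly w \<in> carrier_mat (n_modes N1 N2) (n_modes N1 N2)"
  by (simp add: convection_mat_def)

lemma convection_mat_index:
  assumes "i < n_modes N1 N2" "j < n_modes N1 N2"
  shows "convection_mat N1 N2 Lx Ly w $$ (i, j) =
    (\<Sum>k<n_modes N1 N2. complex_of_real (interaction N1 N2 Lx Ly i j k) * w $ k)"
proof -
  obtain c d n m where modes: "mode N1 N2 i = (c, d)" "mode N1 N2 j = (n, m)"
    by (metis surj_pair)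
  define g where "g k = (let (p, q) = mode N1 N2 k in
          if p + n = c \<and> q + m = d
          then w $ k * complex_of_real
                 (of_int (p * m - q * n) * Lx * Ly / ((of_int p)\<^sup>2 * Ly\<^sup>2 + (of_int q)\<^sup>2 * Lx\<^sup>2))
          else 0)" for k
  have "convection_mat N1 N2 Lx Ly w $$ (i, j)
      = - (\<Sum>k | k < n_modes N1 N2 \<and> mode N1 N2 k \<noteq> (0, 0). g k)"
    using assms by (simp add: convection_mat_def modes g_def)
  also have "(\<Sum>k | k < n_modes N1 N2 \<and> mode N1 N2 k \<noteq> (0, 0). g k)
      = (\<Sum>k<n_modes N1 N2. if mode N1 N2 k \<noteq> (0, 0) then g k else 0)"
    by (simp add: sum.If_cases Int_def lessThan_def conj_commute)
  also have "- \<dots> = (\<Sum>k<n_modes N1 N2. complex_of_real (interaction N1 N2 Lx Ly i j k) * w $ k)"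
    unfolding sum_negf[symmetric]
    by (intro sum.cong refl) (auto simp: g_def interaction_def modes split: prod.splits)
  finally show ?thesis .
qed

text \<open>The source of energy conservation. The numerator \<open>p m - q n\<close> is the determinant of
  \<open>(p, q)\<close> and \<open>(n, m)\<close>, which does not change when \<open>(n, m)\<close> is replaced by
  \<open>(c, d) = (p, q) + (n, m)\<close>; reversing the sign of \<open>(p, q)\<close> therefore reverses the sign of the
  coefficient, while it exchanges input and output mode.\<close>

lemma interaction_reflect:
  assumes "even N1" "even N2" "k < n_modes N1 N2"
  shows "interaction N1 N2 Lx Ly j i (n_modes N1 N2 - Suc k) = - interaction N1 N2 Lx Ly i j k"
proof -
  obtain c d n m p q where modes: "mode N1 N2 i = (c, d)" "mode N1 N2 j = (n, m)"
    "mode N1 N2 k = (p, q)"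
    by (metis surj_pair)
  have refl: "mode N1 N2 (n_modes N1 N2 - Suc k) = (- p, - q)"
    using mode_reflect[OF assms] modes by simp
  have iff: "- p + c = n \<longleftrightarrow> p + n = c" "- q + d = m \<longleftrightarrow> q + m = d" by auto
  show ?thesis
  proof (cases "(p, q) \<noteq> (0, 0) \<and> p + n = c \<and> q + m = d")
    case True
    then have cd: "c = p + n" "d = q + m" by auto
    have "- p * d - - q * c = - (p * m - q * n)" by (simp add: cd algebra_simps)
    moreover have "interaction N1 N2 Lx Ly j i (n_modes N1 N2 - Suc k)
        = - (of_int (- p * d - - q * c) * Lx * Ly / ((of_int p)\<^sup>2 * Ly\<^sup>2 + (of_int q)\<^sup>2 * Lx\<^sup>2))"
      using True iff by (simp add: interaction_def modes refl del: of_int_diff of_int_mult)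
    moreover have "interaction N1 N2 Lx Ly i j k
        = - (of_int (p * m - q * n) * Lx * Ly / ((of_int p)\<^sup>2 * Ly\<^sup>2 + (of_int q)\<^sup>2 * Lx\<^sup>2))"
      using True by (simp add: interaction_def modes del: of_int_diff of_int_mult)
    ultimately show ?thesis
      by (simp only: of_int_minus)
  next
    case False
    then show ?thesis using iff by (auto simp: interaction_def modes refl)
  qed
qed

lemma real_zero_mean_reflect:
  assumes "even N1" "even N2" "real_zero_mean N1 N2 w" "k < n_modes N1 N2"
  shows "w $ (n_modes N1 N2 - Suc k) = cnj (w $ k)"
  using assms mode_reflect[OF assms(1,2,4)] unfolding real_zero_mean_def by simp

text \<open>Conjugating an entry replaces \<open>w\<close> by its reflection, because \<open>w\<close> represents a real
  function; after reindexing the sum by the reflection of modes, the sign change of the interaction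
  coefficients remains.\<close>

lemma convection_mat_skew:
  assumes ev: "even N1" "even N2" and w: "real_zero_mean N1 N2 w"
  shows "mat_adjoint (convection_mat N1 N2 Lx Ly w) = - convection_mat N1 N2 Lx Ly w"
    (is "mat_adjoint ?B = - ?B")
proof (rule eq_matI)
  let ?N = "n_modes N1 N2"
  fix i j assume "i < dim_row (- ?B)" "j < dim_col (- ?B)"
  then have ij: "i < ?N" "j < ?N" by (simp_all add: convection_mat_def)
  have bij: "bij_betw (\<lambda>k. ?N - Suc k) {..<?N} {..<?N}"
    by (rule bij_betw_byWitness[where f'="\<lambda>k. ?N - Suc k"]) auto
  have "?B $$ (j, i) = (\<Sum>k<?N. complex_of_real (interaction N1 N2 Lx Ly j i (?N - Suc k)) * w $ (?N - Suc k))"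
    unfolding convection_mat_index[OF ij(2,1)]
    by (rule sum.reindex_bij_betw[OF bij, symmetric])
  also have "\<dots> = - cnj (?B $$ (i, j))"
    unfolding convection_mat_index[OF ij] cnj_sum sum_negf[symmetric]
    by (intro sum.cong refl)
       (simp add: interaction_reflect[OF ev] real_zero_mean_reflect[OF ev w])
  finally show "mat_adjoint ?B $$ (i, j) = (- ?B) $$ (i, j)"
    using ij carrier_matD[OF convection_mat_carrier]
    by (simp add: mat_adjoint_index[OF convection_mat_carrier ij])
qed (use carrier_matD[OF mat_adjoint_carrier[OF convection_mat_carrier]] in
     \<open>simp_all add: convection_mat_def\<close>)

lemma convection_energy_conservation:
  assumes "even N1" "even N2" "real_zero_mean N1 N2 w" "v \<in> carrier_vec (n_modes N1 N2)"
  shows "rinner (convection_mat N1 N2 Lx Ly w *\<^sub>v v) v = 0"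
proof -
  let ?B = "convection_mat N1 N2 Lx Ly w"
  have Bv: "?B *\<^sub>v v \<in> carrier_vec (n_modes N1 N2)"
    using assms by (intro mult_mat_vec_carrier[OF convection_mat_carrier])
  have "rinner (?B *\<^sub>v v) v = rinner v (- (?B *\<^sub>v v))"
    unfolding rinner_adjoint[OF convection_mat_carrier assms(4,4)] convection_mat_skew[OF assms(1-3)]
    using assms(4) by (subst uminus_mult_mat_vec) (auto simp: convection_mat_def)
  also have "\<dots> = - rinner (?B *\<^sub>v v) v"
    using rinner_uminus_right[OF assms(4) Bv] rinner_commute[OF assms(4) Bv] by simp
  finally show ?thesis by simp
qed

lemma convection_mat_diff:
  assumes "v \<in> carrier_vec (n_modes N1 N2)" "w \<in> carrier_vec (n_modes N1 N2)"
  shows "convection_mat N1 N2 Lx Ly (v - w)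
    = convection_mat N1 N2 Lx Ly v - convection_mat N1 N2 Lx Ly w"
proof (rule eq_matI)
  fix i j assume "i < dim_row (convection_mat N1 N2 Lx Ly v - convection_mat N1 N2 Lx Ly w)"
    "j < dim_col (convection_mat N1 N2 Lx Ly v - convection_mat N1 N2 Lx Ly w)"
  then have ij: "i < n_modes N1 N2" "j < n_modes N1 N2" by (simp_all add: convection_mat_def)
  have "convection_mat N1 N2 Lx Ly (v - w) $$ (i, j)
      = convection_mat N1 N2 Lx Ly v $$ (i, j) - convection_mat N1 N2 Lx Ly w $$ (i, j)"
    using assms by (simp add: convection_mat_index[OF ij] right_diff_distrib sum_subtractf)
  then show "convection_mat N1 N2 Lx Ly (v - w) $$ (i, j)
      = (convection_mat N1 N2 Lx Ly v - convection_mat N1 N2 Lx Ly w) $$ (i, j)"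
    using ij by (simp add: convection_mat_def)
qed (simp_all add: convection_mat_def)

lemma Psi_mat_carrier [simp]: "Psi_mat N \<in> carrier_mat N N"
  by (simp add: Psi_mat_def Let_def)

lemma Psi_mat_hermitian: "mat_adjoint (Psi_mat N) = Psi_mat N"
proof (rule eq_matI)
  fix i j assume "i < dim_row (Psi_mat N)" "j < dim_col (Psi_mat N)"
  then have "i < N" "j < N" by (simp_all add: Psi_mat_def Let_def)
  then show "mat_adjoint (Psi_mat N) $$ (i, j) = Psi_mat N $$ (i, j)"
    by (simp add: mat_adjoint_index[OF Psi_mat_carrier]) (auto simp: Psi_mat_def Let_def add.commute)
qed (use carrier_matD[OF mat_adjoint_carrier[OF Psi_mat_carrier]] in
     \<open>simp_all add: Psi_mat_def Let_def\<close>)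

lemma Psi_mult_vec_index:
  assumes N: "N = 2 * n + 1" and k: "k < N" and v: "v \<in> carrier_vec N"
  shows "(Psi_mat N *\<^sub>v v) $ k = complex_of_real (1 / sqrt 2) *
    (if k < n then v $ k + v $ (2 * n - k) else if n < k then v $ (2 * n - k) - v $ k else 0)"
proof -
  define d :: complex where "d = (if k < n then 1 else if n < k then - 1 else 0)"
  have "(Psi_mat N *\<^sub>v v) $ k = (\<Sum>j<N. Psi_mat N $$ (k, j) * v $ j)"
    by (rule mult_mat_vec_index_sum[OF Psi_mat_carrier v k])
  also have "\<dots> = complex_of_real (1 / sqrt 2) *
      (\<Sum>j<N. (if j = k then d * v $ j else 0) + (if j = 2 * n - k then (if k = n then 0 else v $ j) else 0))"
    unfolding sum_distrib_left using k
    by (intro sum.cong refl) (auto simp: Psi_mat_def Let_def N d_def)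
  also have "(\<Sum>j<N. (if j = k then d * v $ j else 0) + (if j = 2 * n - k then (if k = n then 0 else v $ j) else 0))
      = d * v $ k + (if k = n then 0 else v $ (2 * n - k))"
    using k N by (simp add: sum.distrib sum.delta)
  also have "d * v $ k + (if k = n then 0 else v $ (2 * n - k))
      = (if k < n then v $ k + v $ (2 * n - k) else if n < k then v $ (2 * n - k) - v $ k else 0)"
    by (auto simp: d_def)
  finally show ?thesis .
qed

text \<open>On a pair of opposite modes \<open>\<Psi>\<close> acts as the Hadamard matrix with rows \<open>(1, 1)\<close> and
  \<open>(1, -1)\<close>, divided by the square root of 2, which squares to the identity; the middle coordinate
  is annihilated.\<close>

lemma Psi_involution_off_middle:
  assumes N: "N = 2 * n + 1" and k: "k < N" "k \<noteq> n" and v: "v \<in> carrier_vec N"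
  shows "(Psi_mat N *\<^sub>v (Psi_mat N *\<^sub>v v)) $ k = v $ k"
proof -
  have Pv: "Psi_mat N *\<^sub>v v \<in> carrier_vec N" by (rule mult_mat_vec_carrier[OF Psi_mat_carrier v])
  define r where "r = complex_of_real (1 / sqrt 2)"
  have half: "r * (r * z) = z / 2" for z
    unfolding r_def by (simp flip: of_real_mult mult.assoc)
  define k' where "k' = 2 * n - k"
  have k': "k' < N" "2 * n - k' = k" using N k by (auto simp: k'_def)
  note index = Psi_mult_vec_index[OF N _ v, folded r_def] Psi_mult_vec_index[OF N _ Pv, folded r_def]
  show ?thesis
  proof (cases "k < n")
    case True
    then have "n < k'" "\<not> k' < n" by (auto simp: k'_def)
    then have "(Psi_mat N *\<^sub>v v) $ k = r * (v $ k + v $ k')"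
      "(Psi_mat N *\<^sub>v v) $ k' = r * (v $ k - v $ k')"
      using True index(1)[OF k(1)] index(1)[OF k'(1)] k'(2) by (simp_all only: k'_def[symmetric] if_True if_False)
    moreover have "(Psi_mat N *\<^sub>v (Psi_mat N *\<^sub>v v)) $ k
        = r * ((Psi_mat N *\<^sub>v v) $ k + (Psi_mat N *\<^sub>v v) $ k')"
      using True index(2)[OF k(1)] by (simp only: k'_def[symmetric] if_True)
    moreover have "r * (r * (v $ k + v $ k') + r * (v $ k - v $ k')) = r * (r * (2 * v $ k))"
      by (simp add: algebra_simps)
    ultimately show ?thesis using half by simp
  next
    case False
    with k have kn: "n < k" by simp
    then have "k' < n" using N k by (auto simp: k'_def)
    then have "(Psi_mat N *\<^sub>v v) $ k = r * (v $ k' - v $ k)"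
      "(Psi_mat N *\<^sub>v v) $ k' = r * (v $ k' + v $ k)"
      using False kn index(1)[OF k(1)] index(1)[OF k'(1)] k'(2) by (simp_all only: k'_def[symmetric] if_True if_False)
    moreover have "(Psi_mat N *\<^sub>v (Psi_mat N *\<^sub>v v)) $ k
        = r * ((Psi_mat N *\<^sub>v v) $ k' - (Psi_mat N *\<^sub>v v) $ k)"
      using False kn index(2)[OF k(1)] by (simp only: k'_def[symmetric] if_True if_False)
    moreover have "r * (r * (v $ k' + v $ k) - r * (v $ k' - v $ k)) = r * (r * (2 * v $ k))"
      by (simp add: algebra_simps)
    ultimately show ?thesis using half by simp
  qed
qed

lemma B1_mat_carrier [simp]:
  "B1_mat N1 N2 Lx Ly v \<in> carrier_mat (n_modes N1 N2) (n_modes N1 N2)"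
  unfolding B1_mat_def Let_def
  by (intro mult_carrier_mat[of _ _ "n_modes N1 N2"] mat_adjoint_carrier Psi_mat_carrier)
     (metis length_map length_upt mat_of_cols_carrier(1) minus_nat.diff_0)

text \<open>By linearity of the convection matrix in the vorticity, the left side is the convection
  matrix of \<open>\<Psi> \<Psi>\<^sup>\<star> u\<close> applied to \<open>v\<close>. The vector \<open>\<Psi> \<Psi>\<^sup>\<star> u\<close> differs from \<open>u\<close> only in the mode
  \<open>(0, 0)\<close>, and that mode generates no velocity.\<close>

lemma B1_mat_mult_vec:
  assumes ev: "even N1" "even N2"
    and v: "v \<in> carrier_vec (n_modes N1 N2)" and u: "u \<in> carrier_vec (n_modes N1 N2)"
  shows "B1_mat N1 N2 Lx Ly v *\<^sub>v u = convection_mat N1 N2 Lx Ly u *\<^sub>v v"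
proof (rule eq_vecI)
  let ?N = "n_modes N1 N2" and ?\<Psi> = "Psi_mat (n_modes N1 N2)"
  define n where "n = (?N - 1) div 2"
  have N: "?N = 2 * n + 1" using n_modes_odd[OF ev] by (auto simp: n_def elim!: oddE)
  define I where "I = interaction N1 N2 Lx Ly"
  define C where "C = mat_of_cols ?N
    (map (\<lambda>j. convection_mat N1 N2 Lx Ly (?\<Psi> *\<^sub>v unit_vec ?N j) *\<^sub>v v) [0..<?N])"
  have C: "C \<in> carrier_mat ?N ?N"
    unfolding C_def by (metis length_map length_upt mat_of_cols_carrier(1) minus_nat.diff_0)
  define s where "s = ?\<Psi> *\<^sub>v u"
  have s: "s \<in> carrier_vec ?N" unfolding s_def by (rule mult_mat_vec_carrier[OF Psi_mat_carrier u])
  have Psi_s: "I i l k = 0 \<or> (\<Sum>j<?N. ?\<Psi> $$ (k, j) * s $ j) = u $ k" if "k < ?N" for i l k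
  proof (cases "k = n")
    case True
    then have "mode N1 N2 k = (0, 0)" using mode_eq_zero_iff[OF ev] by (simp add: n_def)
    then show ?thesis by (simp add: I_def interaction_def Let_def split: prod.splits)
  next
    case False
    then show ?thesis
      using Psi_involution_off_middle[OF N that False u]
        mult_mat_vec_index_sum[OF Psi_mat_carrier s that] by (simp add: s_def)
  qed
  fix i assume "i < dim_vec (convection_mat N1 N2 Lx Ly u *\<^sub>v v)"
  then have i: "i < ?N" by (simp add: convection_mat_def)
  have Psi_unit: "(?\<Psi> *\<^sub>v unit_vec ?N j) $ k = ?\<Psi> $$ (k, j)" if "k < ?N" "j < ?N" for j k
    using that carrier_matD[OF Psi_mat_carrier] by simp
  have C_index: "C $$ (i, j) = (\<Sum>l<?N. (\<Sum>k<?N. complex_of_real (I i l k) * ?\<Psi> $$ (k, j)) * v $ l)"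
    if j: "j < ?N" for j
  proof -
    have "C $$ (i, j) = (convection_mat N1 N2 Lx Ly (?\<Psi> *\<^sub>v unit_vec ?N j) *\<^sub>v v) $ i"
      unfolding C_def using i j by (simp add: mat_of_cols_index)
    also have "\<dots> = (\<Sum>l<?N. convection_mat N1 N2 Lx Ly (?\<Psi> *\<^sub>v unit_vec ?N j) $$ (i, l) * v $ l)"
      by (rule mult_mat_vec_index_sum[OF convection_mat_carrier v i])
    also have "\<dots> = (\<Sum>l<?N. (\<Sum>k<?N. complex_of_real (I i l k) * ?\<Psi> $$ (k, j)) * v $ l)"
      using i j Psi_unit by (intro sum.cong refl) (simp add: convection_mat_index I_def)
    finally show ?thesis .
  qed
  have "(B1_mat N1 N2 Lx Ly v *\<^sub>v u) $ i = (C *\<^sub>v s) $ i"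
    using assoc_mult_mat_vec[OF C Psi_mat_carrier u]
    by (simp add: B1_mat_def Let_def C_def[symmetric] Psi_mat_hermitian s_def)
  also have "\<dots> = (\<Sum>j<?N. \<Sum>l<?N. \<Sum>k<?N. complex_of_real (I i l k) * ?\<Psi> $$ (k, j) * v $ l * s $ j)"
    unfolding mult_mat_vec_index_sum[OF C s i]
    by (intro sum.cong refl) (simp add: C_index sum_distrib_right)
  also have "\<dots> = (\<Sum>l<?N. \<Sum>k<?N. \<Sum>j<?N. complex_of_real (I i l k) * ?\<Psi> $$ (k, j) * v $ l * s $ j)"
    by (subst sum.swap) (intro sum.cong refl sum.swap)
  also have "\<dots> = (\<Sum>l<?N. \<Sum>k<?N. complex_of_real (I i l k) * (\<Sum>j<?N. ?\<Psi> $$ (k, j) * s $ j) * v $ l)"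
    by (simp add: sum_distrib_left sum_distrib_right mult_ac)
  also have "\<dots> = (\<Sum>l<?N. \<Sum>k<?N. complex_of_real (I i l k) * u $ k * v $ l)"
  proof (intro sum.cong refl)
    fix l k assume "k \<in> {..<?N}"
    then show "complex_of_real (I i l k) * (\<Sum>j<?N. ?\<Psi> $$ (k, j) * s $ j) * v $ l
        = complex_of_real (I i l k) * u $ k * v $ l"
      using Psi_s[of k i l] by auto
  qed
  also have "\<dots> = (convection_mat N1 N2 Lx Ly u *\<^sub>v v) $ i"
    unfolding mult_mat_vec_index_sum[OF convection_mat_carrier v i]
    by (intro sum.cong refl) (simp add: convection_mat_index[OF i] I_def sum_distrib_right)
  finally show "(B1_mat N1 N2 Lx Ly v *\<^sub>v u) $ i = (convection_mat N1 N2 Lx Ly u *\<^sub>v v) $ i" .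
qed (simp add: carrier_matD[OF B1_mat_carrier] convection_mat_def)

lemma diffusion_mat_carrier [simp]:
  "diffusion_mat N1 N2 Lx Ly \<nu> \<in> carrier_mat (n_modes N1 N2) (n_modes N1 N2)"
  by (simp add: diffusion_mat_def)

lemma diffusion_mat_mult_vec_index:
  assumes "v \<in> carrier_vec (n_modes N1 N2)" "j < n_modes N1 N2"
  shows "(diffusion_mat N1 N2 Lx Ly \<nu> *\<^sub>v v) $ j
    = complex_of_real (- \<nu> * laplace_eig Lx Ly (mode N1 N2 j)) * v $ j"
proof -
  have "(diffusion_mat N1 N2 Lx Ly \<nu> *\<^sub>v v) $ j = (\<Sum>k<n_modes N1 N2.
      if k = j then complex_of_real (- \<nu> * laplace_eig Lx Ly (mode N1 N2 k)) * v $ k else 0)"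
    unfolding mult_mat_vec_index_sum[OF diffusion_mat_carrier assms]
    using assms by (intro sum.cong refl) (auto simp: diffusion_mat_def mat_diag_def)
  then show ?thesis using assms by simp
qed

lemma diffusion_mat_dissipative:
  assumes "0 \<le> \<nu>" "v \<in> carrier_vec (n_modes N1 N2)"
  shows "rinner (diffusion_mat N1 N2 Lx Ly \<nu> *\<^sub>v v) v \<le> 0"
proof -
  have "rinner (diffusion_mat N1 N2 Lx Ly \<nu> *\<^sub>v v) v
      = (\<Sum>j<n_modes N1 N2. - \<nu> * laplace_eig Lx Ly (mode N1 N2 j) * (cmod (v $ j))\<^sup>2)"
    unfolding rinner_eq_sum[OF mult_mat_vec_carrier[OF diffusion_mat_carrier assms(2)] assms(2)] Re_sum
  proof (intro sum.cong refl)
    fix j assume "j \<in> {..<n_modes N1 N2}"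
    moreover have "Re (complex_of_real a * z * cnj z) = a * (cmod z)\<^sup>2" for a z
      by (simp add: mult.assoc complex_mult_cnj cmod_power2)
    ultimately show "Re ((diffusion_mat N1 N2 Lx Ly \<nu> *\<^sub>v v) $ j * cnj (v $ j))
        = - \<nu> * laplace_eig Lx Ly (mode N1 N2 j) * (cmod (v $ j))\<^sup>2"
      by (simp only: diffusion_mat_mult_vec_index[OF assms(2)] lessThan_iff)
  qed
  also have "\<dots> \<le> 0"
  proof (rule sum_nonpos)
    fix j
    have "0 \<le> laplace_eig Lx Ly (mode N1 N2 j)"
      by (auto simp: laplace_eig_def split: prod.splits)
    then show "- \<nu> * laplace_eig Lx Ly (mode N1 N2 j) * (cmod (v $ j))\<^sup>2 \<le> 0"
      using assms(1) by (intro mult_nonpos_nonneg) auto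
  qed
  finally show ?thesis .
qed

text \<open>The mode \<open>(0, 0)\<close> is not damped, and no mode is amplified.\<close>

lemma max_eigval_diffusion_mat:
  assumes ev: "even N1" "even N2" and "0 \<le> \<nu>"
  shows "max_eigval (diffusion_mat N1 N2 Lx Ly \<nu>) = 0"
  unfolding max_eigval_def
proof (rule Max_eqI)
  let ?A = "diffusion_mat N1 N2 Lx Ly \<nu>" and ?N = "n_modes N1 N2"
  show "finite {r. eigenvalue ?A (complex_of_real r)}"
    by (rule finite_real_eigenvalues[OF diffusion_mat_carrier])
  show "r \<le> 0" if ev_r: "r \<in> {r. eigenvalue ?A (complex_of_real r)}" for r
  proof -
    obtain v where v: "v \<in> carrier_vec ?N" "0 < rinner v v" "rinner (?A *\<^sub>v v) v = r * rinner v v"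
      using eigenvalue_rinner[OF diffusion_mat_carrier] ev_r by blast
    then have "r * rinner v v \<le> 0" using diffusion_mat_dissipative[OF assms(3) v(1)] by metis
    then show ?thesis using v(2) by (simp add: mult_le_0_iff)
  qed
  define n where "n = (?N - 1) div 2"
  have n: "n < ?N" by (simp add: n_def n_modes_def)
  have "mode N1 N2 n = (0, 0)" using mode_eq_zero_iff[OF ev] by (simp add: n_def)
  then have "?A *\<^sub>v unit_vec ?N n = 0 \<cdot>\<^sub>v unit_vec ?N n"
    by (intro eq_vecI)
       (auto simp: diffusion_mat_mult_vec_index laplace_eig_def carrier_matD[OF diffusion_mat_carrier]
         unit_vec_def simp del: index_mult_mat_vec)
  moreover have "unit_vec ?N n \<noteq> (0\<^sub>v ?N :: complex vec)"
    using n by (metis index_unit_vec(2) index_zero_vec(1) zero_neq_one)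
  ultimately have "eigenvalue ?A 0"
    unfolding eigenvalue_def eigenvector_def
    by (intro exI[of _ "unit_vec ?N n"]) (simp add: carrier_matD[OF diffusion_mat_carrier])
  then show "0 \<in> {r. eigenvalue ?A (complex_of_real r)}" by simp
qed

section \<open>The estimation error\<close>

text \<open>The right sides of the state and the filter equation at one time, tested against the
  error \<open>e = x - y\<close>. The convection terms differ by \<open>B x e + B e y\<close>, where the first part is
  orthogonal to \<open>e\<close> and the second equals \<open>B1 e\<close>; this quadratic nonlinearity thus enters only
  through a matrix that depends on the known filter state. Young's inequality, weighted by \<open>Qt\<close>,
  trades the unknown input for its ellipsoidal bound 1 and the form of \<open>D Qt D\<^sup>\<star>\<close>. What remains
  is the quadratic form of the matrix inequality.\<close>

lemma error_dissipation:
  fixes N1 N2 M :: nat and Lx Ly q :: real and A D H P Qt :: "complex mat" and x y f :: "complex vec"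
  defines "N \<equiv> n_modes N1 N2"
  defines "B \<equiv> convection_mat N1 N2 Lx Ly" and "B1 \<equiv> B1_mat N1 N2 Lx Ly y"
  assumes ev: "even N1" "even N2"
    and x: "x \<in> carrier_vec N" "real_zero_mean N1 N2 x" and y: "y \<in> carrier_vec N"
    and A: "A \<in> carrier_mat N N" "\<And>v. v \<in> carrier_vec N \<Longrightarrow> rinner (A *\<^sub>v v) v \<le> 0"
    and D: "D \<in> carrier_mat N N" and H: "H \<in> carrier_mat M N"
    and P: "P \<in> carrier_mat N N" "mat_adjoint P = P"
    and Q: "pos_def N Qt" and f: "f \<in> carrier_vec N" "inv_form Qt f \<le> 1"
    and LMI: "pd_less N (B1 + mat_adjoint B1 + D * Qt * mat_adjoint D
       - P * mat_adjoint H * H - mat_adjoint H * H * P) (complex_of_real (- q) \<cdot>\<^sub>m 1\<^sub>m N)"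
  shows "2 * rinner ((B x *\<^sub>v x + A *\<^sub>v x + D *\<^sub>v f)
      - (B y *\<^sub>v y + A *\<^sub>v y + (P * mat_adjoint H) *\<^sub>v (H *\<^sub>v x - H *\<^sub>v y))) (x - y)
    \<le> 1 - q * rinner (x - y) (x - y)"
proof -
  define e where "e = x - y"
  have e: "e \<in> carrier_vec N" using x y by (simp add: e_def)
  have B: "B w \<in> carrier_mat N N" for w by (simp add: B_def N_def)
  have B1: "B1 \<in> carrier_mat N N" by (simp add: B1_def N_def)
  have Qt: "Qt \<in> carrier_mat N N" using pos_defD(1)[OF Q] .
  note adj = mat_adjoint_carrier
  note mv = mult_mat_vec_carrier
  define G where "G = P * mat_adjoint H * H"
  have PH: "P * mat_adjoint H \<in> carrier_mat N M" by (rule mult_carrier_mat[OF P(1) adj[OF H]])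
  have HH: "mat_adjoint H * H \<in> carrier_mat N N" by (rule mult_carrier_mat[OF adj[OF H] H])
  have G: "G \<in> carrier_mat N N" unfolding G_def by (rule mult_carrier_mat[OF PH H])
  define V where "V = B1 + mat_adjoint B1 + D * Qt * mat_adjoint D - G - mat_adjoint H * H * P"

  \<comment> \<open>each term of the matrix inequality as a quadratic form in the error\<close>
  have form_B1: "rinner (B1 *\<^sub>v e) e = rinner (B x *\<^sub>v y) e - rinner (B y *\<^sub>v y) e"
  proof -
    have "B1 *\<^sub>v e = B e *\<^sub>v y"
      unfolding B1_def B_def using ev y e by (intro B1_mat_mult_vec) (auto simp: N_def)
    also have "\<dots> = B x *\<^sub>v y - B y *\<^sub>v y"
      using x y B unfolding e_def B_def N_def
      by (simp add: convection_mat_diff minus_mult_distrib_mat_vec[where nr="n_modes N1 N2" and nc="n_modes N1 N2"])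
    finally show ?thesis using mv[OF B y] e by (simp add: rinner_diff_left[where n=N])
  qed
  have form_B1_adj: "rinner (mat_adjoint B1 *\<^sub>v e) e = rinner (B1 *\<^sub>v e) e"
    using rinner_adjoint[OF B1 e e] rinner_commute[OF e mv[OF adj[OF B1] e]] by simp
  have form_D: "rinner ((D * Qt * mat_adjoint D) *\<^sub>v e) e
      = rinner (Qt *\<^sub>v (mat_adjoint D *\<^sub>v e)) (mat_adjoint D *\<^sub>v e)"
  proof -
    have De: "mat_adjoint D *\<^sub>v e \<in> carrier_vec N" using mv[OF adj[OF D] e] .
    have "(D * Qt * mat_adjoint D) *\<^sub>v e = D *\<^sub>v (Qt *\<^sub>v (mat_adjoint D *\<^sub>v e))"
      using assoc_mult_mat_vec[OF mult_carrier_mat[OF D Qt] adj[OF D] e]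
        assoc_mult_mat_vec[OF D Qt De] by simp
    then show ?thesis using rinner_adjoint[OF D mv[OF Qt De] e] by simp
  qed
  have form_HHP: "rinner ((mat_adjoint H * H * P) *\<^sub>v e) e = rinner (G *\<^sub>v e) e"
  proof -
    have Pe: "P *\<^sub>v e \<in> carrier_vec N" and He: "H *\<^sub>v e \<in> carrier_vec M"
      and HPe: "H *\<^sub>v (P *\<^sub>v e) \<in> carrier_vec M"
      using mv[OF P(1) e] mv[OF H e] mv[OF H mv[OF P(1) e]] .
    have "(mat_adjoint H * H * P) *\<^sub>v e = mat_adjoint H *\<^sub>v (H *\<^sub>v (P *\<^sub>v e))"
      using assoc_mult_mat_vec[OF HH P(1) e] assoc_mult_mat_vec[OF adj[OF H] H Pe] by simp
    then have "rinner ((mat_adjoint H * H * P) *\<^sub>v e) e = rinner e (mat_adjoint H *\<^sub>v (H *\<^sub>v (P *\<^sub>v e)))"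
      using rinner_commute[OF e mv[OF adj[OF H] HPe]] by simp
    also have "\<dots> = rinner (H *\<^sub>v e) (H *\<^sub>v (P *\<^sub>v e))"
      using rinner_adjoint[OF H e HPe] by simp
    also have "\<dots> = rinner (H *\<^sub>v (P *\<^sub>v e)) (H *\<^sub>v e)"
      by (rule rinner_commute[OF He HPe])
    also have "\<dots> = rinner (P *\<^sub>v e) (mat_adjoint H *\<^sub>v (H *\<^sub>v e))"
      by (rule rinner_adjoint[OF H Pe He])
    also have "\<dots> = rinner e (P *\<^sub>v (mat_adjoint H *\<^sub>v (H *\<^sub>v e)))"
      using rinner_adjoint[OF P(1) e mv[OF adj[OF H] He]] P(2) by simp
    also have "P *\<^sub>v (mat_adjoint H *\<^sub>v (H *\<^sub>v e)) = G *\<^sub>v e"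
      unfolding G_def using assoc_mult_mat_vec[OF PH H e] assoc_mult_mat_vec[OF P(1) adj[OF H] He] by simp
    also have "rinner e (G *\<^sub>v e) = rinner (G *\<^sub>v e) e" by (rule rinner_commute[OF e mv[OF G e]])
    finally show ?thesis .
  qed
  have DQD: "D * Qt * mat_adjoint D \<in> carrier_mat N N" and HHP: "mat_adjoint H * H * P \<in> carrier_mat N N"
    using D Qt adj[OF D] HH P(1) by (auto intro!: mult_carrier_mat[of _ N N])
  have form_V: "rinner (V *\<^sub>v e) e = 2 * rinner (B1 *\<^sub>v e) e
      + rinner (Qt *\<^sub>v (mat_adjoint D *\<^sub>v e)) (mat_adjoint D *\<^sub>v e) - 2 * rinner (G *\<^sub>v e) e"
  proof -
    have "V *\<^sub>v e = B1 *\<^sub>v e + mat_adjoint B1 *\<^sub>v e + (D * Qt * mat_adjoint D) *\<^sub>v e - G *\<^sub>v e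
        - (mat_adjoint H * H * P) *\<^sub>v e"
      unfolding V_def using B1 adj[OF B1] DQD G HHP e
      by (simp add: minus_mult_distrib_mat_vec[where nr=N and nc=N]
          add_mult_distrib_mat_vec[where nr=N and nc=N] minus_carrier_mat del: assoc_mult_mat assoc_add_mat)
    then show ?thesis
      using mv[OF B1 e] mv[OF adj[OF B1] e] mv[OF DQD e] mv[OF G e] mv[OF HHP e] e
      by (simp add: rinner_diff_left[where n=N] rinner_add_left[where n=N]
          form_B1_adj form_D form_HHP del: assoc_mult_mat assoc_mult_mat_vec)
  qed
  have V: "V \<in> carrier_mat N N" unfolding V_def using HHP by (rule minus_carrier_mat)
  have LMI_form: "rinner (V *\<^sub>v e) e \<le> - q * rinner e e"
  proof -
    have "pos_def N (complex_of_real (- q) \<cdot>\<^sub>m 1\<^sub>m N - V)"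
      using LMI by (simp add: pd_less_def V_def G_def)
    then have "0 \<le> rinner ((complex_of_real (- q) \<cdot>\<^sub>m 1\<^sub>m N - V) *\<^sub>v e) e"
      using pos_defD(4) e by blast
    also have "(complex_of_real (- q) \<cdot>\<^sub>m 1\<^sub>m N - V) *\<^sub>v e = complex_of_real (- q) \<cdot>\<^sub>v e - V *\<^sub>v e"
      using V e by (subst minus_mult_distrib_mat_vec[where nr=N and nc=N]) auto
    also have "rinner \<dots> e = - q * rinner e e - rinner (V *\<^sub>v e) e"
      using mv[OF V e] e by (simp add: rinner_diff_left[where n=N] rinner_smult_left[where n=N] del: of_real_minus)
    finally show ?thesis by simp
  qed

  have skew: "rinner (B x *\<^sub>v x) e - rinner (B x *\<^sub>v y) e = 0"
    using convection_energy_conservation[OF ev x(2), of e Lx Ly] e x y mv[OF B x(1)] mv[OF B y]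
      mult_minus_distrib_mat_vec[OF B[of x] x(1) y]
    by (simp add: B_def N_def e_def rinner_diff_left[where n="n_modes N1 N2"])
  have diffusion: "rinner (A *\<^sub>v x) e - rinner (A *\<^sub>v y) e \<le> 0"
    using A(2)[OF e] e mv[OF A(1) x(1)] mv[OF A(1) y] mult_minus_distrib_mat_vec[OF A(1) x(1) y]
    by (simp add: e_def rinner_diff_left[where n=N])
  have gain: "(P * mat_adjoint H) *\<^sub>v (H *\<^sub>v x - H *\<^sub>v y) = G *\<^sub>v e"
    unfolding G_def e_def
    using assoc_mult_mat_vec[OF PH H e] mult_minus_distrib_mat_vec[OF H x(1) y] by (simp add: e_def del: assoc_mult_mat)
  have input: "2 * rinner (D *\<^sub>v f) e
      \<le> 1 + rinner (Qt *\<^sub>v (mat_adjoint D *\<^sub>v e)) (mat_adjoint D *\<^sub>v e)"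
    using inv_form_young[OF Q f(1) mv[OF adj[OF D] e]] rinner_adjoint[OF D f(1) e] f(2) by simp
  have "rinner ((B x *\<^sub>v x + A *\<^sub>v x + D *\<^sub>v f) - (B y *\<^sub>v y + A *\<^sub>v y + G *\<^sub>v e)) e
      = rinner (B x *\<^sub>v x) e + rinner (A *\<^sub>v x) e + rinner (D *\<^sub>v f) e
        - (rinner (B y *\<^sub>v y) e + rinner (A *\<^sub>v y) e + rinner (G *\<^sub>v e) e)"
    using mv[OF B x(1)] mv[OF B y] mv[OF A(1) x(1)] mv[OF A(1) y] mv[OF D f(1)] mv[OF G e] e
    by (simp add: rinner_diff_left[where n=N] rinner_add_left[where n=N])
  then show ?thesis
    unfolding gain e_def[symmetric]
    using form_V form_B1 LMI_form skew diffusion input by linarith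
qed

theorem corollary4p3:
  fixes N1 N2 N M :: nat and Lx Ly \<nu> q :: real
    and T :: "(real \<times> real \<Rightarrow> complex) \<Rightarrow> (real \<times> real \<Rightarrow> complex)"
    and h :: "nat \<Rightarrow> real \<times> real \<Rightarrow> complex"
    and A D H F S :: "complex mat"
    and Q R :: "real \<Rightarrow> complex mat"
    and P :: "real \<Rightarrow> complex vec \<Rightarrow> complex mat"
    and \<E> :: "(complex vec \<times> (real \<Rightarrow> complex vec) \<times> (real \<Rightarrow> complex vec)) set"
    and \<omega> \<omega>h ::
      "complex vec \<times> (real \<Rightarrow> complex vec) \<times> (real \<Rightarrow> complex vec) \<Rightarrow> real \<Rightarrow> complex vec"
  assumes "0 < N1" "even N1" "0 < N2" "even N2" "N = n_modes N1 N2" "0 < M"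
    and "0 < Lx" "0 < Ly" "0 < \<nu>"
    and "L2_bounded_operator Lx Ly T" "\<And>k. k < M \<Longrightarrow> h k \<in> L2 Lx Ly"
    and "A = diffusion_mat N1 N2 Lx Ly \<nu>"
    and "D = operator_mat N1 N2 Lx Ly T"
    and "H = observation_mat N1 N2 Lx Ly M h"
    and "F = 0\<^sub>m M M"
    and "\<And>t. 0 \<le> t \<Longrightarrow> pos_def N (Q t)" "\<And>t. 0 \<le> t \<Longrightarrow> pos_def M (R t)" "pos_def N S"
    and "\<E> = uncertainty_set N1 N2 Lx Ly A D M Q R S"
    and "0 < q"
    and "\<And>t x. 0 \<le> t \<Longrightarrow> x \<in> carrier_vec N \<Longrightarrow>
           P t x \<in> carrier_mat N N \<and> mat_adjoint (P t x) = P t x"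
    and state: "\<And>\<omega>0 f \<eta>. (\<omega>0, f, \<eta>) \<in> \<E> \<Longrightarrow>
           state_solution N1 N2 Lx Ly A D \<omega>0 f (\<omega> (\<omega>0, f, \<eta>))"
    and filter: "\<And>\<omega>0 f \<eta>. (\<omega>0, f, \<eta>) \<in> \<E> \<Longrightarrow>
           filter_solution N1 N2 Lx Ly A H P
             (output_signal H F (\<omega> (\<omega>0, f, \<eta>)) \<eta>) (\<omega>h (\<omega>0, f, \<eta>))"
    and LMI: "\<And>e t. e \<in> \<E> \<Longrightarrow> 0 \<le> t \<Longrightarrow>
           pd_less N
             (B1_mat N1 N2 Lx Ly (\<omega>h e t) + mat_adjoint (B1_mat N1 N2 Lx Ly (\<omega>h e t))
              + D * Q t * mat_adjoint D
              - P t (\<omega>h e t) * mat_adjoint H * H - mat_adjoint H * H * P t (\<omega>h e t))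
             (complex_of_real (- q) \<cdot>\<^sub>m 1\<^sub>m N)"
  shows "\<forall>t\<ge>0. (SUP e\<in>\<E>. ereal (sq_error (\<omega> e) (\<omega>h e) t))
                 \<le> ereal (C1 A q + C2 A S q * exp (- (2 * \<bar>max_eigval A\<bar> + q) * t))"
proof (intro allI impI SUP_least)
  fix t :: real and e :: "complex vec \<times> (real \<Rightarrow> complex vec) \<times> (real \<Rightarrow> complex vec)"
  assume t: "0 \<le> t" and e: "e \<in> \<E>"
  note ev = \<open>even N1\<close> \<open>even N2\<close>
  obtain \<omega>0 f \<eta> where e_eq: "e = (\<omega>0, f, \<eta>)" by (metis surj_pair)
  define W V where "W = \<omega> e" and "V = \<omega>h e"
  have N: "N = n_modes N1 N2" by fact
  have A: "A \<in> carrier_mat N N" and D: "D \<in> carrier_mat N N" and H: "H \<in> carrier_mat M N"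
    unfolding \<open>A = _\<close> \<open>D = _\<close> \<open>H = _\<close> N
    by (simp_all add: operator_mat_def observation_mat_def)
  have \<omega>0: "\<omega>0 \<in> carrier_vec N" "inv_form S \<omega>0 \<le> 1"
    and f: "\<And>s. 0 \<le> s \<Longrightarrow> f s \<in> carrier_vec N" and \<eta>: "\<And>s. 0 \<le> s \<Longrightarrow> \<eta> s \<in> carrier_vec M"
    and noise: "\<And>s. 0 \<le> s \<Longrightarrow> inv_form (Q s) (f s) + inv_form (R s) (\<eta> s) \<le> 1"
    using e unfolding e_eq \<open>\<E> = _\<close> uncertainty_set_def measurable_signal_def N by auto
  have W_sol: "state_solution N1 N2 Lx Ly A D \<omega>0 f W"
    using state[of \<omega>0 f \<eta>] e by (simp add: e_eq W_def)
  have V_sol: "filter_solution N1 N2 Lx Ly A H P (output_signal H F W \<eta>) V"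
    using filter[of \<omega>0 f \<eta>] e by (simp add: e_eq W_def V_def)
  \<comment> \<open>uniqueness identifies \<open>W\<close> with the real solution of zero mean provided by the uncertainty set\<close>
  have W_real: "real_zero_mean N1 N2 (W s)" if "0 \<le> s" for s
  proof -
    obtain w where "\<forall>w'. state_solution N1 N2 Lx Ly A D \<omega>0 f w' \<longrightarrow> (\<forall>t\<ge>0. w' t = w t)"
      "\<forall>t\<ge>0. real_zero_mean N1 N2 (w t)"
      using e unfolding e_eq \<open>\<E> = _\<close> uncertainty_set_def by auto
    with W_sol \<open>0 \<le> s\<close> show ?thesis by metis
  qed
  have W: "W s \<in> carrier_vec N" and V: "V s \<in> carrier_vec N" if "0 \<le> s" for s
    using W_sol V_sol \<open>0 \<le> s\<close>
    unfolding state_solution_def filter_solution_def solves_ivp_def N by auto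
  have f_bound: "inv_form (Q s) (f s) \<le> 1" if "0 \<le> s" for s
    using noise[OF that] inv_form_nonneg[OF assms(17)[OF that] \<eta>[OF that]] by simp
  define z where "z j s = W s $ j - V s $ j" for j s
  define rW where "rW s = convection_mat N1 N2 Lx Ly (W s) *\<^sub>v W s + A *\<^sub>v W s + D *\<^sub>v f s" for s
  define rV where "rV s = convection_mat N1 N2 Lx Ly (V s) *\<^sub>v V s + A *\<^sub>v V s
    + (P s (V s) * mat_adjoint H) *\<^sub>v (output_signal H F W \<eta> s - H *\<^sub>v V s)" for s
  have z_eq: "z j s = (W s - V s) $ j" if "0 \<le> s" "j < N" for j s
    using V[OF that(1)] that(2) by (simp add: z_def)
  have sq_norm: "(\<Sum>j<N. (cmod (z j s))\<^sup>2) = rinner (W s - V s) (W s - V s)" if "0 \<le> s" for s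
    using W[OF that] V[OF that] that by (subst rinner_self_eq_sum[of _ N]) (auto simp: z_eq)
  have "(\<Sum>j<N. (cmod (z j t))\<^sup>2)
      \<le> 1 / q + ((\<Sum>j<N. (cmod (z j 0))\<^sup>2) - 1 / q) * exp (- q * t)"
  proof (rule sq_norm_exp_decay[OF \<open>0 < q\<close> t])
    show "abs_cont_on 0 t (z j)" if "j < N" for j
      using W_sol V_sol that t
      unfolding z_def state_solution_def filter_solution_def solves_ivp_def N
      by (intro abs_cont_on_diff) auto
    have "AE s in lebesgue_on {0..}. \<forall>j<N.
        ((\<lambda>s. W s $ j) has_vector_derivative (rW s $ j)) (at s within {0..})"
      using W_sol unfolding state_solution_def solves_ivp_def rW_def N by auto
    moreover have "AE s in lebesgue_on {0..}. \<forall>j<N.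
        ((\<lambda>s. V s $ j) has_vector_derivative (rV s $ j)) (at s within {0..})"
      using V_sol unfolding filter_solution_def solves_ivp_def rV_def N by auto
    ultimately have "AE s in lebesgue_on {0..}. \<forall>j<N.
        (z j has_vector_derivative (rW s $ j - rV s $ j)) (at s within {0..})"
      by eventually_elim (auto simp: z_def[abs_def] intro!: has_vector_derivative_diff)
    then have "AE s in lebesgue. s \<in> {0..} \<longrightarrow> (\<forall>j<N.
        (z j has_vector_derivative (rW s $ j - rV s $ j)) (at s within {0..}))"
      by (subst (asm) AE_restrict_space_iff) auto
    then show "AE s in lebesgue_on {0..t}. \<exists>z'.
      (\<forall>j<N. (z j has_vector_derivative z' j) (at s within {0..t})) \<and>
      2 * Re (\<Sum>j<N. z' j * cnj (z j s)) \<le> 1 - q * (\<Sum>j<N. (cmod (z j s))\<^sup>2)"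
    proof (subst AE_restrict_space_iff, simp, eventually_elim, intro impI)
      fix s assume der: "s \<in> {0..} \<longrightarrow> (\<forall>j<N.
          (z j has_vector_derivative (rW s $ j - rV s $ j)) (at s within {0..}))"
        and "s \<in> {0..t}"
      then have s: "0 \<le> s" by simp
      have P: "P s (V s) \<in> carrier_mat N N" "mat_adjoint (P s (V s)) = P s (V s)"
        using assms(21)[OF s V[OF s]] by auto
      have no_noise: "output_signal H F W \<eta> s = H *\<^sub>v W s"
      proof -
        have "0\<^sub>m M M *\<^sub>v \<eta> s = 0\<^sub>v M" using \<eta>[OF s] by (intro eq_vecI) auto
        then show ?thesis
          using mult_mat_vec_carrier[OF H W[OF s]] unfolding output_signal_def \<open>F = _\<close> by simp
      qed
      have rW: "rW s \<in> carrier_vec N" and rV: "rV s \<in> carrier_vec N"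
        unfolding rW_def rV_def using carrier_matD[OF D] carrier_matD[OF P(1)]
        by (auto intro!: carrier_vecI)
      have E: "W s - V s \<in> carrier_vec N" using W[OF s] V[OF s] by simp
      have "2 * rinner (rW s - rV s) (W s - V s) \<le> 1 - q * rinner (W s - V s) (W s - V s)"
        unfolding rW_def rV_def no_noise N
      proof (rule error_dissipation)
        show "pd_less (n_modes N1 N2) (B1_mat N1 N2 Lx Ly (V s) + mat_adjoint (B1_mat N1 N2 Lx Ly (V s))
            + D * Q s * mat_adjoint D - P s (V s) * mat_adjoint H * H - mat_adjoint H * H * P s (V s))
            (complex_of_real (- q) \<cdot>\<^sub>m 1\<^sub>m (n_modes N1 N2))"
          using LMI[OF e s] by (simp add: V_def N)
        show "rinner (A *\<^sub>v v) v \<le> 0" if "v \<in> carrier_vec (n_modes N1 N2)" for v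
          unfolding \<open>A = _\<close> using diffusion_mat_dissipative that \<open>0 < \<nu>\<close> by simp
      qed (use ev W[OF s] V[OF s] W_real[OF s] A D H P assms(16)[OF s] f[OF s] f_bound[OF s] N in auto)
      also have "rinner (rW s - rV s) (W s - V s) = Re (\<Sum>j<N. (rW s $ j - rV s $ j) * cnj (z j s))"
        using rW rV E s by (subst rinner_eq_sum[where n=N]) (auto intro!: sum.cong arg_cong[where f=Re] simp: z_eq)
      finally have "2 * Re (\<Sum>j<N. (rW s $ j - rV s $ j) * cnj (z j s))
          \<le> 1 - q * (\<Sum>j<N. (cmod (z j s))\<^sup>2)"
        using sq_norm[OF s] by simp
      moreover have "\<forall>j<N. (z j has_vector_derivative (rW s $ j - rV s $ j)) (at s within {0..t})"
        using der s by (auto intro: has_vector_derivative_within_subset)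
      ultimately show "\<exists>z'. (\<forall>j<N. (z j has_vector_derivative z' j) (at s within {0..t})) \<and>
          2 * Re (\<Sum>j<N. z' j * cnj (z j s)) \<le> 1 - q * (\<Sum>j<N. (cmod (z j s))\<^sup>2)"
        by (intro exI[of _ "\<lambda>j. rW s $ j - rV s $ j"] conjI)
    qed
  qed
  moreover have "(\<Sum>j<N. (cmod (z j 0))\<^sup>2) \<le> max_eigval S"
  proof -
    have "W 0 - V 0 = \<omega>0"
      using W_sol V_sol \<omega>0(1)
      unfolding state_solution_def filter_solution_def solves_ivp_def N by (auto intro!: eq_vecI)
    then have init: "(\<Sum>j<N. (cmod (z j 0))\<^sup>2) = rinner \<omega>0 \<omega>0" using sq_norm[of 0] by simp
    have "rinner \<omega>0 \<omega>0 \<le> max_eigval S * inv_form S \<omega>0"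
      by (rule rinner_self_le_max_eigval_inv_form[OF \<open>pos_def N S\<close> \<omega>0(1)])
    also have "\<dots> \<le> max_eigval S * 1"
      using \<omega>0(2) max_eigval_nonneg[OF \<open>pos_def N S\<close>] N by (intro mult_left_mono) (auto simp: n_modes_def)
    finally show ?thesis using init by simp
  qed
  then have "((\<Sum>j<N. (cmod (z j 0))\<^sup>2) - 1 / q) * exp (- q * t) \<le> (max_eigval S - 1 / q) * exp (- q * t)"
    by (intro mult_right_mono) auto
  ultimately have "(\<Sum>j<N. (cmod (z j t))\<^sup>2) \<le> 1 / q + (max_eigval S - 1 / q) * exp (- q * t)"
    by linarith
  moreover have "max_eigval A = 0"
    unfolding \<open>A = _\<close> using max_eigval_diffusion_mat[OF ev] \<open>0 < \<nu>\<close> by simp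
  ultimately show "ereal (sq_error (\<omega> e) (\<omega>h e) t)
      \<le> ereal (C1 A q + C2 A S q * exp (- (2 * \<bar>max_eigval A\<bar> + q) * t))"
    using sq_norm[OF t] by (simp add: sq_error_def C1_def C2_def rinner_def W_def V_def)
qed

end
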